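(* Let $m, r$ and $d$ be integers such that $d \geq 1$ and $2 \leq 2r \leq m-1$. Then $$\overline{\mathrm{POL}^{ss,neig}_{d,2r,m}}=\mathrm{POL}^{ss}_{d,2r,m}.$$
   Context: All matrix polynomials have coefficients in $\mathbb{C}$. The degree of a matrix polynomial is the largest power of $\lambda$ with a nonzero matrix coefficient. The (normal) rank of a matrix polynomial is its rank over the field $\mathbb{C}(\lambda)$. $\mathrm{POL}^{ss}_{d,m}$ is the vector space of $m\times m$ skew-symmetric matrix polynomials $P(\lambda)=\sum_{i=0}^d\lambda^iA_i$ ($A_i\in\mathbb{C}^{m\times m}$, $A_i^T=-A_i$) of degree at most $d$, equipped with the distance $d(P,P')=\left(\sum_{i=0}^d\|A_i-A_i'\|_F^2\right)^{1/2}$, where $P'(\lambda)=\sum_{i=0}^d\lambda^iA_i'$; $\overline{\mathcal{S}}$ denotes closure in the resulting (Euclidean) topology. $\mathrm{POL}^{ss}_{d,2r,m}$ is the set of $P\in\mathrm{POL}^{ss}_{d,m}$ with normal rank at most $2r$. Eigenvalues: $\alpha\in\mathbb{C}$ is a finite eigenvalue of $P(\lambda)$ if it is a root of at least one of the invariant polynomials of $P(\lambda)$ (the nonzero diagonal entries of its Smith form over $\mathbb{C}[\lambda]$); equivalently, $\operatorname{rank}P(\alpha)<\operatorname{rank}(P)$. $\infty$ is an eigenvalue of $P(\lambda)$, regarded as a polynomial of grade $d$, if $0$ is an eigenvalue of $\mathrm{rev}_dP(\lambda):=\lambda^dP(1/\lambda)$. "$P$ has no eigenvalues" means no finite and no infinite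 eigenvalues. Then $$\mathrm{POL}^{ss,neig}_{d,2r,m}:=\{P(\lambda)\in\mathrm{POL}^{ss}_{d,2r,m} : \operatorname{rank}(P)=2r,\ \deg(P)=d,\ P(\lambda)\text{ has no eigenvalues}\}.$$ *)

theory Defs
  imports
    "HOL-Analysis.Analysis"
    "HOL-Computational_Algebra.Computational_Algebra"
    "Jordan_Normal_Form.Determinant"
    "Jordan_Normal_Form.DL_Rank"
begin

text \<open>
  An \<open>m \<times> m\<close> matrix polynomial is an element of \<open>carrier_mat m m :: complex poly mat set\<close>.
  The coefficient matrix of \<open>\<lambda>\<^sup>k\<close> takes \<open>m\<close> as an argument, so that it is \<open>m \<times> m\<close> even when \<open>P\<close>
  is not; this makes the distance below symmetric on the whole type, as \<^locale>\<open>Metric_space\<close>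
  demands.
\<close>

definition coeff_mat :: "nat \<Rightarrow> complex poly mat \<Rightarrow> nat \<Rightarrow> complex mat" where
  "coeff_mat m P k = mat m m (\<lambda>(i, j). coeff (P $$ (i, j)) k)"

text \<open>Unspecified for the zero matrix polynomial.\<close>

definition pol_degree :: "nat \<Rightarrow> complex poly mat \<Rightarrow> nat" where
  "pol_degree m P = Max {k. coeff_mat m P k \<noteq> 0\<^sub>m m m}"

text \<open>The rank over the field of fractions \<open>\<complex>(\<lambda>)\<close>.\<close>

definition normal_rank :: "nat \<Rightarrow> complex poly mat \<Rightarrow> nat" where
  "normal_rank m P = vec_space.rank m (map_mat to_fract P)"

definition unimodular :: "complex poly mat \<Rightarrow> bool" where
  "unimodular U \<longleftrightarrow> (\<exists>c. c \<noteq> 0 \<and> det U = [:c:])"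

text \<open>
  Divisibility of consecutive diagonal entries puts the zero entries last, since \<open>0 dvd p\<close> only
  if \<open>p = 0\<close>.
\<close>

definition smith_form :: "nat \<Rightarrow> complex poly mat \<Rightarrow> complex poly mat \<Rightarrow> bool" where
  "smith_form m P S \<longleftrightarrow>
     S \<in> carrier_mat m m \<and> diagonal_mat S \<and>
     (\<forall>i<m. S $$ (i, i) \<noteq> 0 \<longrightarrow> lead_coeff (S $$ (i, i)) = 1) \<and>
     (\<forall>i. Suc i < m \<longrightarrow> S $$ (i, i) dvd S $$ (Suc i, Suc i)) \<and>
     (\<exists>U V. U \<in> carrier_mat m m \<and> V \<in> carrier_mat m m \<and> unimodular U \<and> unimodular V \<and>
            U * P * V = S)"

definition invariant_polynomials :: "nat \<Rightarrow> complex poly mat \<Rightarrow> complex poly set" where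
  "invariant_polynomials m P = {S $$ (i, i) | S i. smith_form m P S \<and> i < m \<and> S $$ (i, i) \<noteq> 0}"

definition finite_eigenvalue :: "nat \<Rightarrow> complex poly mat \<Rightarrow> complex \<Rightarrow> bool" where
  "finite_eigenvalue m P \<alpha> \<longleftrightarrow> (\<exists>p \<in> invariant_polynomials m P. poly p \<alpha> = 0)"

text \<open>
  \<open>\<lambda>\<^sup>d P(1/\<lambda>) = (\<Sum>k\<le>d. \<lambda>\<^sup>k A\<^bsub>d-k\<^esub>)\<close> for \<open>P = (\<Sum>k\<le>d. \<lambda>\<^sup>k A\<^sub>k)\<close>. The grade \<open>d\<close> is fixed, so
  this is not the entrywise \<^const>\<open>reflect_poly\<close>.
\<close>

definition rev_pol :: "nat \<Rightarrow> complex poly mat \<Rightarrow> complex poly mat" where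
  "rev_pol d P = map_mat (\<lambda>p. \<Sum>k\<le>d. monom (coeff p (d - k)) k) P"

definition infinite_eigenvalue :: "nat \<Rightarrow> nat \<Rightarrow> complex poly mat \<Rightarrow> bool" where
  "infinite_eigenvalue d m P \<longleftrightarrow> finite_eigenvalue m (rev_pol d P) 0"

definition no_eigenvalues :: "nat \<Rightarrow> nat \<Rightarrow> complex poly mat \<Rightarrow> bool" where
  "no_eigenvalues d m P \<longleftrightarrow> (\<nexists>\<alpha>. finite_eigenvalue m P \<alpha>) \<and> \<not> infinite_eigenvalue d m P"

definition POL_ss :: "nat \<Rightarrow> nat \<Rightarrow> complex poly mat set" where
  "POL_ss d m = {P \<in> carrier_mat m m.
     (\<forall>k\<le>d. transpose_mat (coeff_mat m P k) = - coeff_mat m P k) \<and>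
     (\<forall>k>d. coeff_mat m P k = 0\<^sub>m m m)}"

text \<open>The second argument is the bound on the rank itself, i.e. \<open>2 * r\<close> in the applications.\<close>

definition POL_ss_rank :: "nat \<Rightarrow> nat \<Rightarrow> nat \<Rightarrow> complex poly mat set" where
  "POL_ss_rank d \<rho> m = {P \<in> POL_ss d m. normal_rank m P \<le> \<rho>}"

definition POL_ss_neig :: "nat \<Rightarrow> nat \<Rightarrow> nat \<Rightarrow> complex poly mat set" where
  "POL_ss_neig d \<rho> m = {P \<in> POL_ss_rank d \<rho> m.
     normal_rank m P = \<rho> \<and> pol_degree m P = d \<and> no_eigenvalues d m P}"

definition frobenius_norm :: "complex mat \<Rightarrow> real" where
  "frobenius_norm A = sqrt (\<Sum>i<dim_row A. \<Sum>j<dim_col A. (cmod (A $$ (i, j)))\<^sup>2)"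

definition pol_dist :: "nat \<Rightarrow> nat \<Rightarrow> complex poly mat \<Rightarrow> complex poly mat \<Rightarrow> real" where
  "pol_dist d m P Q = sqrt (\<Sum>k\<le>d. (frobenius_norm (coeff_mat m P k - coeff_mat m Q k))\<^sup>2)"

lemma pol_dist_conv_L2_set:
  "pol_dist d m P Q =
     L2_set (\<lambda>(k, i, j). cmod (coeff (P $$ (i, j)) k - coeff (Q $$ (i, j)) k))
       ({..d} \<times> {..<m} \<times> {..<m})"
proof -
  have "(frobenius_norm (coeff_mat m P k - coeff_mat m Q k))\<^sup>2 =
      (\<Sum>i<m. \<Sum>j<m. (cmod (coeff (P $$ (i, j)) k - coeff (Q $$ (i, j)) k))\<^sup>2)" for k
    by (simp add: frobenius_norm_def coeff_mat_def sum_nonneg)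
  then show ?thesis
    by (simp add: pol_dist_def L2_set_def sum.cartesian_product case_prod_unfold)
qed

text \<open>
  Makes \<^const>\<open>Metric_space.mtopology\<close> on \<^term>\<open>POL_ss d m\<close> with \<^term>\<open>pol_dist d m\<close> the intended
  metric topology.
\<close>

lemma Metric_space_POL_ss: "Metric_space (POL_ss d m) (pol_dist d m)"
proof
  fix P Q R
  let ?I = "{..d} \<times> {..<m} \<times> {..<m}"
  let ?c = "\<lambda>P (k, i, j). coeff (P $$ (i, j)) k :: complex"
  show "0 \<le> pol_dist d m P Q"
    by (simp add: pol_dist_conv_L2_set L2_set_nonneg)
  show "pol_dist d m P Q = pol_dist d m Q P"
    by (simp add: pol_dist_conv_L2_set norm_minus_commute)
  show "pol_dist d m P Q = 0 \<longleftrightarrow> P = Q" if PQ: "P \<in> POL_ss d m" "Q \<in> POL_ss d m"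
  proof
    assume "pol_dist d m P Q = 0"
    then have le: "coeff (P $$ (i, j)) k = coeff (Q $$ (i, j)) k" if "k \<le> d" "i < m" "j < m" for i j k
      using that by (force simp: pol_dist_conv_L2_set L2_set_eq_0_iff)
    have gt: "coeff (X $$ (i, j)) k = 0" if "X \<in> POL_ss d m" "k > d" "i < m" "j < m" for X i j k
    proof -
      have "coeff_mat m X k $$ (i, j) = 0\<^sub>m m m $$ (i, j)"
        using that by (simp add: POL_ss_def)
      then show ?thesis using that by (simp add: coeff_mat_def)
    qed
    have "P $$ (i, j) = Q $$ (i, j)" if "i < m" "j < m" for i j
      using le gt[OF PQ(1)] gt[OF PQ(2)] that by (metis poly_eqI not_le)
    moreover have "P \<in> carrier_mat m m" "Q \<in> carrier_mat m m"
      using PQ by (auto simp: POL_ss_def)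
    ultimately show "P = Q" by (intro eq_matI) auto
  qed (simp add: pol_dist_conv_L2_set L2_set_eq_0_iff)
  have "pol_dist d m P R = L2_set (\<lambda>x. cmod (?c P x - ?c R x)) ?I"
    by (simp add: pol_dist_conv_L2_set case_prod_unfold)
  also have "\<dots> \<le> L2_set (\<lambda>x. cmod (?c P x - ?c Q x) + cmod (?c Q x - ?c R x)) ?I"
    by (rule L2_set_mono) (auto simp: dist_norm[symmetric] dist_triangle)
  also have "\<dots> \<le> L2_set (\<lambda>x. cmod (?c P x - ?c Q x)) ?I + L2_set (\<lambda>x. cmod (?c Q x - ?c R x)) ?I"
    by (rule L2_set_triangle_ineq)
  also have "\<dots> = pol_dist d m P Q + pol_dist d m Q R"
    by (simp add: pol_dist_conv_L2_set case_prod_unfold)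
  finally show "pol_dist d m P R \<le> pol_dist d m P Q + pol_dist d m Q R" .
qed

end

theory Submission
  imports Defs
begin

text \<open>
  Rank at most \<open>2 r\<close> is a closed condition, since minors are continuous. For density write \<open>P\<close> of rank
  at most \<open>2 r\<close> as \<open>M\<^sup>T K M\<close> with \<open>K\<close> skew-symmetric, where row \<open>i\<close> of \<open>M\<close> has degree at most \<open>\<delta>\<^sub>i\<close>
  and \<open>K\<^sub>i\<^sub>j\<close> has degree at most \<open>d - \<delta>\<^sub>i - \<delta>\<^sub>j\<close>, starting from \<open>M = 1\<close>, \<open>K = P\<close>, \<open>\<delta> = 0\<close>. As long as \<open>K\<close>
  is singular at some point of the projective line, a linear factor can be moved from a row and
  column of \<open>K\<close> to a row of \<open>M\<close>, which raises one \<open>\<delta>\<^sub>i\<close>; a row with \<open>\<delta>\<^sub>i > d\<close> is dropped. In the end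
  \<open>K\<close> is nonsingular at every point, so its size is the rank of \<open>P\<close>, and it can be padded to
  \<open>2 r\<close>. Since \<open>2 r < m\<close>, a small perturbation of \<open>M\<close> within the degree bounds has rank \<open>2 r\<close>
  at every point of the projective line: rank deficiency of a \<open>2 r \<times> m\<close> matrix has codimension at
  least 2. The corresponding perturbation of \<open>P\<close> then has rank \<open>2 r\<close> at every point, infinity
  included.
\<close>

unbundle no vec_syntax and no fps_syntax

section \<open>Rank over a field\<close>

lemma mult_mat_zero_vec:
  fixes A :: "'a :: semiring_0 mat"
  assumes "A \<in> carrier_mat n k"
  shows "A *\<^sub>v 0\<^sub>v k = 0\<^sub>v n"
  using assms by (intro eq_vecI) (auto simp: scalar_prod_def)

lemma wide_mat_kernel:
  fixes B :: "'a :: field mat"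
  assumes B: "B \<in> carrier_mat k n" and "k < n"
  shows "\<exists>v\<in>carrier_vec n. v \<noteq> 0\<^sub>v n \<and> B *\<^sub>v v = 0\<^sub>v k"
proof -
  define C where "C = mat n n (\<lambda>(i, j). if i < k then B $$ (i, j) else 0)"
  have C: "C \<in> carrier_mat n n" by (simp add: C_def)
  have "det (transpose_mat C) = 0"
  proof (subst det_0_iff_vec_prod_zero)
    show "transpose_mat C \<in> carrier_mat n n" using C by simp
    have "transpose_mat C *\<^sub>v unit_vec n k = 0\<^sub>v n"
      using assms by (intro eq_vecI) (auto simp: C_def)
    then show "\<exists>v. v \<in> carrier_vec n \<and> v \<noteq> 0\<^sub>v n \<and> transpose_mat C *\<^sub>v v = 0\<^sub>v n"
      using \<open>k < n\<close> by (intro exI[of _ "unit_vec n k"]) auto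
  qed
  then have "det C = 0" using det_transpose[OF C] by simp
  then obtain v where v: "v \<in> carrier_vec n" "v \<noteq> 0\<^sub>v n" "C *\<^sub>v v = 0\<^sub>v n"
    using det_0_iff_vec_prod_zero[OF C] by auto
  have "B *\<^sub>v v = 0\<^sub>v k"
  proof (rule eq_vecI)
    fix i assume i: "i < dim_vec (0\<^sub>v k :: 'a vec)"
    then have "row B i = row C i" using assms by (auto simp: C_def)
    moreover have "(C *\<^sub>v v) $ i = 0" using v(3) i \<open>k < n\<close> by simp
    ultimately show "(B *\<^sub>v v) $ i = (0\<^sub>v k :: 'a vec) $ i" using i assms C by simp
  qed (use B in simp)
  with v show ?thesis by blast
qed

lemma det_mult_narrow:
  fixes B C :: "'a :: field mat"
  assumes B: "B \<in> carrier_mat n k" and C: "C \<in> carrier_mat k n" and "k < n"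
  shows "det (B * C) = 0"
proof -
  obtain v where v: "v \<in> carrier_vec n" "v \<noteq> 0\<^sub>v n" "C *\<^sub>v v = 0\<^sub>v k"
    using wide_mat_kernel[OF C \<open>k < n\<close>] by auto
  have "B * C *\<^sub>v v = B *\<^sub>v (C *\<^sub>v v)" using B C v(1) by simp
  also have "\<dots> = 0\<^sub>v n" unfolding v(3) using B by (rule mult_mat_zero_vec)
  finally show ?thesis
    using det_0_iff_vec_prod_zero[of "B * C" n] B C v by auto
qed

lemma rank_factorization:
  fixes A :: "'a :: field mat"
  assumes A: "A \<in> carrier_mat n m"
  defines "\<rho> \<equiv> vec_space.rank n A"
  obtains J G where "\<And>l. l < \<rho> \<Longrightarrow> J l < m" "G \<in> carrier_mat \<rho> m"
    "A = mat n \<rho> (\<lambda>(a, l). A $$ (a, J l)) * G"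
    "\<And>v. v \<in> carrier_vec \<rho> \<Longrightarrow> mat n \<rho> (\<lambda>(a, l). A $$ (a, J l)) *\<^sub>v v = 0\<^sub>v n \<Longrightarrow> v = 0\<^sub>v \<rho>"
proof -
  interpret vec_space "TYPE('a)" n .
  have cols: "set (cols A) \<subseteq> carrier_vec n" using cols_dim A by blast
  obtain S where S: "maximal S (\<lambda>T. T \<subseteq> set (cols A) \<and> lin_indpt T)"
    using maximal_exists[of "(\<lambda>T. T \<subseteq> set (cols A) \<and> lin_indpt T)" "card (set (cols A))" "{}"]
    by (meson List.finite_set card_mono empty_iff empty_subsetI finite_lin_indpt2 rev_finite_subset)
  then have S': "S \<subseteq> set (cols A)" "lin_indpt S" by (auto simp: maximal_def)
  obtain ss where ss: "set ss = S" "distinct ss"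
    using finite_distinct_list[of S] S'(1) finite_subset by blast
  have len: "length ss = \<rho>"
    using rank_card_indpt[OF A S] distinct_card[OF ss(2)] ss(1) by (simp add: \<rho>_def)
  have ssc: "set ss \<subseteq> carrier_vec n" using S' cols ss by auto
  have "\<exists>j. l < \<rho> \<longrightarrow> j < m \<and> ss ! l = col A j" for l
  proof (cases "l < \<rho>")
    case True
    then have "ss ! l \<in> set (cols A)" using S' ss len by (metis nth_mem subsetD)
    then show ?thesis using A by (auto simp: in_set_conv_nth)
  qed auto
  then obtain J where J: "\<And>l. l < \<rho> \<Longrightarrow> J l < m \<and> ss ! l = col A (J l)" by metis
  define B where "B = mat n \<rho> (\<lambda>(a, l). A $$ (a, J l))"
  have B: "B \<in> carrier_mat n \<rho>" by (simp add: B_def)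
  have colsB: "cols B = ss"
    using A J len by (intro nth_equalityI) (auto simp: B_def intro!: eq_vecI)
  have inj: "v = 0\<^sub>v \<rho>" if "v \<in> carrier_vec \<rho>" "B *\<^sub>v v = 0\<^sub>v n" for v
    using lin_depI[OF B that(1) _ that(2)] S'(2) ss colsB by auto
  have "\<exists>g\<in>carrier_vec \<rho>. B *\<^sub>v g = col A b" if b: "b < m" for b
  proof (cases "col A b \<in> S")
    case True
    then obtain l where l: "l < \<rho>" "ss ! l = col A b" using ss len by (auto simp: in_set_conv_nth)
    have "B *\<^sub>v unit_vec \<rho> l = col B l"
      using l B by (intro eq_vecI) auto
    also have "\<dots> = col A b" using l colsB B len by (metis cols_nth carrier_matD(2))
    finally show ?thesis using l by (intro bexI[of _ "unit_vec \<rho> l"]) auto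
  next
    case False
    have bc: "col A b \<in> set (cols A)" using b A by (metis carrier_matD(2) cols_length cols_nth nth_mem)
    let ?C = "mat_of_cols n (col A b # ss)"
    have C: "?C \<in> carrier_mat n (Suc \<rho>)" using mat_of_cols_carrier(1)[of n "col A b # ss"] len by simp
    have colsC: "cols ?C = col A b # ss" using ssc bc cols A by (intro cols_mat_of_cols) auto
    have dis: "distinct (cols ?C)" using False ss colsC by simp
    have "lin_dep (insert (col A b) S)"
      using S S' False bc unfolding maximal_def by (metis insert_subset insertI1 subset_insertI)
    then have "lin_dep (set (cols ?C))" using colsC ss by simp
    from lin_depE[OF C this dis] obtain v where v: "v \<in> carrier_vec (Suc \<rho>)" "v \<noteq> 0\<^sub>v (Suc \<rho>)" "?C *\<^sub>v v = 0\<^sub>v n"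
      by blast
    define w where "w = vec \<rho> (\<lambda>l. v $ Suc l)"
    have w: "w \<in> carrier_vec \<rho>" by (simp add: w_def)
    have eq: "v $ 0 * A $$ (a, b) + (B *\<^sub>v w) $ a = 0" if a: "a < n" for a
    proof -
      have "0 = (?C *\<^sub>v v) $ a" using v(3) a by simp
      also have "\<dots> = (\<Sum>l<Suc \<rho>. ?C $$ (a, l) * v $ l)"
        using a v(1) len
        by (auto simp: scalar_prod_def lessThan_atLeast0 simp del: sum.lessThan_Suc sum.op_ivl_Suc
            intro!: sum.cong)
      also have "\<dots> = ?C $$ (a, 0) * v $ 0 + (\<Sum>l<\<rho>. ?C $$ (a, Suc l) * v $ Suc l)"
        by (simp add: sum.lessThan_Suc_shift del: sum.lessThan_Suc)
      also have "?C $$ (a, 0) = A $$ (a, b)" using a A b len by (simp add: mat_of_cols_def)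
      also have "(\<Sum>l<\<rho>. ?C $$ (a, Suc l) * v $ Suc l) = (\<Sum>l<\<rho>. B $$ (a, l) * w $ l)"
        using a len J A by (intro sum.cong) (auto simp: mat_of_cols_def B_def w_def)
      also have "\<dots> = (B *\<^sub>v w) $ a"
        using a B w by (simp add: scalar_prod_def lessThan_atLeast0)
      finally show ?thesis by (simp add: mult.commute)
    qed
    have v0: "v $ 0 \<noteq> 0"
    proof
      assume "v $ 0 = 0"
      then have "B *\<^sub>v w = 0\<^sub>v n" using eq B by (intro eq_vecI) auto
      then have "w = 0\<^sub>v \<rho>" using inj w by blast
      then have "v $ i = 0" if "i < Suc \<rho>" for i
        using \<open>v $ 0 = 0\<close> that by (cases i) (auto simp: w_def vec_eq_iff)
      then show False using v(1,2) by (auto simp: vec_eq_iff)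
    qed
    have "B *\<^sub>v ((- 1 / v $ 0) \<cdot>\<^sub>v w) = col A b"
    proof (rule eq_vecI)
      fix a assume a: "a < dim_vec (col A b)"
      then have a': "a < n" using A by simp
      have "(B *\<^sub>v ((- 1 / v $ 0) \<cdot>\<^sub>v w)) $ a = (- 1 / v $ 0) * (B *\<^sub>v w) $ a"
        using a' B w by (simp add: mult_mat_vec[OF B w])
      also have "(B *\<^sub>v w) $ a = - (v $ 0 * A $$ (a, b))" using eq[OF a'] by (simp add: eq_neg_iff_add_eq_0 add.commute)
      finally show "(B *\<^sub>v ((- 1 / v $ 0) \<cdot>\<^sub>v w)) $ a = col A b $ a"
        using v0 a' A b by simp
    qed (use A B in auto)
    then show ?thesis using w by (intro bexI[of _ "(- 1 / v $ 0) \<cdot>\<^sub>v w"]) auto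
  qed
  then obtain g where g: "\<And>b. b < m \<Longrightarrow> g b \<in> carrier_vec \<rho> \<and> B *\<^sub>v g b = col A b" by metis
  define G where "G = mat \<rho> m (\<lambda>(l, b). g b $ l)"
  have G: "G \<in> carrier_mat \<rho> m" by (simp add: G_def)
  have "A = B * G"
  proof (rule eq_matI)
    fix i j assume ij: "i < dim_row (B * G)" "j < dim_col (B * G)"
    then have j: "j < m" and i: "i < n" using G B by auto
    have "col G j = g j" using g[OF j] j by (auto simp: G_def)
    then have "(B * G) $$ (i, j) = (B *\<^sub>v g j) $ i" using ij i j B G by simp
    then show "A $$ (i, j) = (B * G) $$ (i, j)" using g[OF j] i j A by simp
  qed (use A B G in auto)
  show thesis
  proof (rule that)
    show "J l < m" if "l < \<rho>" for l using J that by simp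
    show "A = mat n \<rho> (\<lambda>(a, l). A $$ (a, J l)) * G" using \<open>A = B * G\<close> unfolding B_def .
  qed (use G inj in \<open>simp_all add: B_def\<close>)
qed

lemma rank_geI:
  fixes A :: "'a :: field mat"
  assumes A: "A \<in> carrier_mat n m" and X: "X \<in> carrier_mat k n" and Y: "Y \<in> carrier_mat m k"
    and d: "det (X * A * Y) \<noteq> 0"
  shows "k \<le> vec_space.rank n A"
proof -
  define \<rho> where "\<rho> = vec_space.rank n A"
  obtain J G where G: "G \<in> carrier_mat \<rho> m"
    and AG: "A = mat n \<rho> (\<lambda>(a, l). A $$ (a, J l)) * G"
    using rank_factorization[OF A] unfolding \<rho>_def by metis
  define B where "B = mat n \<rho> (\<lambda>(a, l). A $$ (a, J l))"
  have B: "B \<in> carrier_mat n \<rho>" by (simp add: B_def)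
  have "X * A * Y = (X * B) * (G * Y)"
    unfolding arg_cong[OF AG, folded B_def, of "\<lambda>A. X * A * Y"]
      assoc_mult_mat[OF X B G, symmetric]
    using X Y B G by (intro assoc_mult_mat) auto
  then show "k \<le> vec_space.rank n A"
    using X Y d det_mult_narrow[of "X * B" k \<rho> "G * Y"] B G unfolding \<rho>_def[symmetric] by force
qed

lemma rank_minorE:
  fixes A :: "'a :: field mat"
  assumes A: "A \<in> carrier_mat n m" and k: "k \<le> vec_space.rank n A"
  obtains I J where "\<And>l. l < k \<Longrightarrow> I l < n" "\<And>l. l < k \<Longrightarrow> J l < m"
    "det (mat k k (\<lambda>(i, j). A $$ (I i, J j))) \<noteq> 0"
proof -
  define \<rho> where "\<rho> = vec_space.rank n A"
  obtain J G where J: "\<And>l. l < \<rho> \<Longrightarrow> J l < m"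
    and inj: "\<And>v. v \<in> carrier_vec \<rho> \<Longrightarrow> mat n \<rho> (\<lambda>(a, l). A $$ (a, J l)) *\<^sub>v v = 0\<^sub>v n \<Longrightarrow> v = 0\<^sub>v \<rho>"
    using rank_factorization[OF A] unfolding \<rho>_def by metis
  define Q where "Q = mat n k (\<lambda>(a, l). A $$ (a, J l))"
  have Q: "Q \<in> carrier_mat n k" by (simp add: Q_def)
  have injQ: "v = 0\<^sub>v k" if v: "v \<in> carrier_vec k" and Qv: "Q *\<^sub>v v = 0\<^sub>v n" for v
  proof -
    define w where "w = vec \<rho> (\<lambda>l. if l < k then v $ l else 0)"
    have "mat n \<rho> (\<lambda>(a, l). A $$ (a, J l)) *\<^sub>v w = Q *\<^sub>v v"
    proof (rule eq_vecI)
      fix i assume i: "i < dim_vec (Q *\<^sub>v v)"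
      have "(\<Sum>l<\<rho>. A $$ (i, J l) * (if l < k then v $ l else 0)) = (\<Sum>l<k. A $$ (i, J l) * v $ l)"
        using k by (intro sum.mono_neutral_cong_right) (auto simp: \<rho>_def)
      then show "(mat n \<rho> (\<lambda>(a, l). A $$ (a, J l)) *\<^sub>v w) $ i = (Q *\<^sub>v v) $ i"
        using i v by (simp add: Q_def w_def scalar_prod_def lessThan_atLeast0)
    qed (simp add: Q_def)
    then have "w = 0\<^sub>v \<rho>" using inj[of w] Qv by (simp add: w_def)
    then have "v $ l = 0" if "l < k" for l
      using that k unfolding w_def \<rho>_def[symmetric] by (auto simp: vec_eq_iff split: if_splits)
    then show ?thesis using v by auto
  qed
  define \<sigma> where "\<sigma> = vec_space.rank k (transpose_mat Q)"
  have QT: "transpose_mat Q \<in> carrier_mat k n" using Q by simp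
  obtain I H where I: "\<And>l. l < \<sigma> \<Longrightarrow> I l < n" and H: "H \<in> carrier_mat \<sigma> n"
    and QH: "transpose_mat Q = mat k \<sigma> (\<lambda>(a, l). transpose_mat Q $$ (a, I l)) * H"
    and injT: "\<And>v. v \<in> carrier_vec \<sigma> \<Longrightarrow> mat k \<sigma> (\<lambda>(a, l). transpose_mat Q $$ (a, I l)) *\<^sub>v v = 0\<^sub>v k \<Longrightarrow> v = 0\<^sub>v \<sigma>"
    using rank_factorization[OF QT] unfolding \<sigma>_def by metis
  define E where "E = mat k \<sigma> (\<lambda>(a, l). transpose_mat Q $$ (a, I l))"
  have E: "E \<in> carrier_mat k \<sigma>" by (simp add: E_def)
  have "\<sigma> = k"
  proof (rule ccontr)
    assume "\<sigma> \<noteq> k"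
    then consider "\<sigma> < k" | "k < \<sigma>" by linarith
    then show False
    proof cases
      case 1
      have ET: "transpose_mat E \<in> carrier_mat \<sigma> k" using E by simp
      from wide_mat_kernel[OF ET 1]
      obtain v where v: "v \<in> carrier_vec k" "v \<noteq> 0\<^sub>v k" "transpose_mat E *\<^sub>v v = 0\<^sub>v \<sigma>" by auto
      have "Q = transpose_mat (E * H)" using QH E_def by (metis transpose_transpose)
      also have "\<dots> = transpose_mat H * transpose_mat E" by (rule transpose_mult[OF E H])
      finally have "Q *\<^sub>v v = transpose_mat H *\<^sub>v (transpose_mat E *\<^sub>v v)"
        using E H v(1) by (simp add: assoc_mult_mat_vec[of _ n \<sigma> _ k])
      also have "\<dots> = 0\<^sub>v n" unfolding v(3) using H by (intro mult_mat_zero_vec) simp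
      finally show False using injQ[OF v(1)] v(2) by simp
    next
      case 2
      from wide_mat_kernel[OF E 2]
      obtain v where v: "v \<in> carrier_vec \<sigma>" "v \<noteq> 0\<^sub>v \<sigma>" "E *\<^sub>v v = 0\<^sub>v k" by auto
      show False using injT[OF v(1)] v(2,3) by (simp add: E_def)
    qed
  qed
  define S where "S = transpose_mat E"
  have Ek: "E \<in> carrier_mat k k" using E \<open>\<sigma> = k\<close> by simp
  have injE: "\<And>v. v \<in> carrier_vec k \<Longrightarrow> E *\<^sub>v v = 0\<^sub>v k \<Longrightarrow> v = 0\<^sub>v k"
    using injT[folded E_def] unfolding \<open>\<sigma> = k\<close> .
  have S: "S \<in> carrier_mat k k" using Ek by (simp add: S_def)
  have "det E \<noteq> 0"
    unfolding det_0_iff_vec_prod_zero[OF Ek] using injE by auto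
  then have dS: "det S \<noteq> 0" using det_transpose[OF Ek] by (simp add: S_def)
  have "S = mat k k (\<lambda>(i, j). A $$ (I i, J j))"
    using I unfolding S_def E_def Q_def \<open>\<sigma> = k\<close> by (intro eq_matI) auto
  then show thesis
    using I J k dS unfolding \<open>\<sigma> = k\<close> \<rho>_def by (intro that[of I J]) auto
qed

lemma minor_eq_product:
  fixes A :: "'a :: field mat"
  assumes A: "A \<in> carrier_mat n m"
    and I: "\<And>l. l < k \<Longrightarrow> I l < n" and J: "\<And>l. l < k \<Longrightarrow> J l < m"
    and d: "det (mat k k (\<lambda>(i, j). A $$ (I i, J j))) \<noteq> 0"
  obtains X Y where "X \<in> carrier_mat k n" "Y \<in> carrier_mat m k" "det (X * A * Y) \<noteq> 0"
proof -
  define X where "X = mat k n (\<lambda>(l, a). if a = I l then 1 else 0 :: 'a)"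
  define Y where "Y = mat m k (\<lambda>(a, l). if a = J l then 1 else 0 :: 'a)"
  have "X * A * Y = mat k k (\<lambda>(i, j). A $$ (I i, J j))"
  proof (rule eq_matI)
    fix i j assume "i < dim_row (mat k k (\<lambda>(i, j). A $$ (I i, J j)))" "j < dim_col (mat k k (\<lambda>(i, j). A $$ (I i, J j)))"
    then have i: "i < k" and j: "j < k" by auto
    have Ii: "I i < n" and Jj: "J j < m" using i j I J by auto
    have XA: "(X * A) $$ (i, b) = A $$ (I i, b)" if "b < m" for b
      using that i Ii A by (simp add: X_def scalar_prod_def sum.delta if_distrib[where f = "\<lambda>x. x * _"] cong: if_cong)
    have "(X * A * Y) $$ (i, j) = (\<Sum>b<m. (X * A) $$ (i, b) * Y $$ (b, j))"
      using i j A by (simp add: scalar_prod_def X_def Y_def lessThan_atLeast0)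
    also have "\<dots> = (\<Sum>b<m. A $$ (I i, b) * (if b = J j then 1 else 0))"
      using XA j by (intro sum.cong) (auto simp: Y_def)
    also have "\<dots> = A $$ (I i, J j)" using Jj by (simp add: if_distrib sum.delta cong: if_cong)
    finally show "(X * A * Y) $$ (i, j) = mat k k (\<lambda>(i, j). A $$ (I i, J j)) $$ (i, j)" using i j by simp
  qed (auto simp: X_def Y_def)
  then show thesis using d by (intro that[of X Y]) (auto simp: X_def Y_def)
qed

lemma rank_ge_minor:
  fixes A :: "'a :: field mat"
  assumes A: "A \<in> carrier_mat n m"
    and "\<And>l. l < k \<Longrightarrow> I l < n" "\<And>l. l < k \<Longrightarrow> J l < m"
    and "det (mat k k (\<lambda>(i, j). A $$ (I i, J j))) \<noteq> 0"
  shows "k \<le> vec_space.rank n A"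
  using minor_eq_product[OF assms] rank_geI[OF A] by metis

lemma rank_ge_iff:
  fixes A :: "'a :: field mat"
  assumes A: "A \<in> carrier_mat n m"
  shows "k \<le> vec_space.rank n A \<longleftrightarrow>
    (\<exists>X Y. X \<in> carrier_mat k n \<and> Y \<in> carrier_mat m k \<and> det (X * A * Y) \<noteq> 0)"
  using rank_geI[OF A] rank_minorE[OF A] minor_eq_product[OF A] by metis

lemma rank_mult_le_inner:
  fixes B C :: "'a :: field mat"
  assumes B: "B \<in> carrier_mat n k" and C: "C \<in> carrier_mat k m"
  shows "vec_space.rank n (B * C) \<le> k"
proof -
  define r where "r = vec_space.rank n (B * C)"
  obtain X Y where X: "X \<in> carrier_mat r n" and Y: "Y \<in> carrier_mat m r" and d: "det (X * (B * C) * Y) \<noteq> 0"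
    using rank_ge_iff[of "B * C" n m r] B C unfolding r_def by auto
  have "X * (B * C) * Y = (X * B) * (C * Y)"
    unfolding assoc_mult_mat[OF X B C, symmetric]
    using X Y B C by (intro assoc_mult_mat) auto
  then show ?thesis
    using det_mult_narrow[of "X * B" r k "C * Y"] d X Y B C unfolding r_def[symmetric] by force
qed

section \<open>Normal rank and eigenvalues\<close>

abbreviation eval_mat :: "complex poly mat \<Rightarrow> complex \<Rightarrow> complex mat" where
  "eval_mat P \<alpha> \<equiv> map_mat (\<lambda>p. poly p \<alpha>) P"

lemma comm_ring_hom_poly: "comm_ring_hom (\<lambda>p. poly p (\<alpha> :: complex))"
  by unfold_locales auto

lemma det_eval_mat: "det (eval_mat A \<alpha>) = poly (det A) \<alpha>"
  by (rule comm_ring_hom.hom_det[OF comm_ring_hom_poly])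

lemma eval_mat_mult:
  assumes "A \<in> carrier_mat n k" "B \<in> carrier_mat k m"
  shows "eval_mat (A * B) \<alpha> = eval_mat A \<alpha> * eval_mat B \<alpha>"
proof -
  interpret comm_ring_hom "\<lambda>p. poly p \<alpha>" by (rule comm_ring_hom_poly)
  show ?thesis using assms by (rule mat_hom_mult)
qed

lemma det_map_to_fract: "det (map_mat to_fract A) = to_fract (det (A :: 'a :: idom mat))"
proof -
  interpret comm_ring_hom "to_fract :: 'a \<Rightarrow> 'a fract" by unfold_locales auto
  show ?thesis by simp
qed

lemma minor_map_mat:
  assumes "A \<in> carrier_mat n m" "\<forall>l<k. I l < n \<and> J l < m"
  shows "mat k k (\<lambda>(i, j). map_mat f A $$ (I i, J j)) = map_mat f (mat k k (\<lambda>(i, j). A $$ (I i, J j)))"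
  using assms by (intro eq_matI) auto

lemma rank_eval_le_normal_rank:
  assumes P: "P \<in> carrier_mat m m"
  shows "vec_space.rank m (eval_mat P \<alpha>) \<le> normal_rank m P"
proof -
  obtain I J where IJ: "\<And>l. l < vec_space.rank m (eval_mat P \<alpha>) \<Longrightarrow> I l < m"
      "\<And>l. l < vec_space.rank m (eval_mat P \<alpha>) \<Longrightarrow> J l < m"
    and d: "det (mat (vec_space.rank m (eval_mat P \<alpha>)) (vec_space.rank m (eval_mat P \<alpha>))
        (\<lambda>(i, j). eval_mat P \<alpha> $$ (I i, J j))) \<noteq> 0"
    using rank_minorE[of "eval_mat P \<alpha>" m m "vec_space.rank m (eval_mat P \<alpha>)"] P by auto
  have IJ': "\<forall>l<vec_space.rank m (eval_mat P \<alpha>). I l < m \<and> J l < m" using IJ by blast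
  have "det (mat (vec_space.rank m (eval_mat P \<alpha>)) (vec_space.rank m (eval_mat P \<alpha>))
      (\<lambda>(i, j). map_mat to_fract P $$ (I i, J j))) \<noteq> 0"
    using d unfolding minor_map_mat[OF P IJ'] det_eval_mat det_map_to_fract by auto
  then show ?thesis
    unfolding normal_rank_def using IJ P by (intro rank_ge_minor[where m = m]) auto
qed

lemma finite_rank_eval_less:
  assumes P: "P \<in> carrier_mat m m"
  shows "finite {\<alpha>. vec_space.rank m (eval_mat P \<alpha>) < normal_rank m P}"
proof -
  obtain I J where IJ: "\<And>l. l < normal_rank m P \<Longrightarrow> I l < m"
      "\<And>l. l < normal_rank m P \<Longrightarrow> J l < m"
    and d: "det (mat (normal_rank m P) (normal_rank m P) (\<lambda>(i, j). map_mat to_fract P $$ (I i, J j))) \<noteq> 0"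
    using rank_minorE[of "map_mat to_fract P" m m "normal_rank m P"] P by (auto simp: normal_rank_def)
  have IJ': "\<forall>l<normal_rank m P. I l < m \<and> J l < m" using IJ by blast
  define q where "q = det (mat (normal_rank m P) (normal_rank m P) (\<lambda>(i, j). P $$ (I i, J j)))"
  have "det (map_mat to_fract (mat (normal_rank m P) (normal_rank m P) (\<lambda>(i, j). P $$ (I i, J j)))) \<noteq> 0"
    using d minor_map_mat[OF P IJ', of to_fract] by simp
  then have "q \<noteq> 0" by (auto simp: q_def det_map_to_fract)
  moreover have "poly q \<alpha> = 0" if "vec_space.rank m (eval_mat P \<alpha>) < normal_rank m P" for \<alpha>
  proof (rule ccontr)
    assume "poly q \<alpha> \<noteq> 0"
    then have "det (mat (normal_rank m P) (normal_rank m P) (\<lambda>(i, j). eval_mat P \<alpha> $$ (I i, J j))) \<noteq> 0"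
      unfolding minor_map_mat[OF P IJ'] det_eval_mat q_def by simp
    then have "normal_rank m P \<le> vec_space.rank m (eval_mat P \<alpha>)"
      using IJ P by (intro rank_ge_minor[where m = m]) auto
    then show False using that by simp
  qed
  ultimately show ?thesis
    by (intro finite_subset[OF _ poly_roots_finite[of q]]) auto
qed

lemma assoc_mult_mat5:
  fixes A :: "'a :: semiring_0 mat"
  assumes X: "X \<in> carrier_mat k n" and U: "U \<in> carrier_mat n p" and A: "A \<in> carrier_mat p q"
    and V: "V \<in> carrier_mat q m" and Y: "Y \<in> carrier_mat m l"
  shows "X * (U * A * V) * Y = (X * U) * A * (V * Y)"
proof -
  have "X * (U * A * V) = X * U * A * V"
    using X U A V assoc_mult_mat[of X k n "U * A" q V m] assoc_mult_mat[of X k n U p A q] by simp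
  then show ?thesis
    using X U A V Y assoc_mult_mat[of "X * U * A" k q V m Y l] by simp
qed

lemma rank_mult_invertible:
  fixes A U V :: "'a :: field mat"
  assumes A: "A \<in> carrier_mat m m" and U: "U \<in> carrier_mat m m" and V: "V \<in> carrier_mat m m"
    and "det U \<noteq> 0" "det V \<noteq> 0"
  shows "vec_space.rank m (U * A * V) = vec_space.rank m A"
proof -
  have le: "vec_space.rank m (U * A * V) \<le> vec_space.rank m A"
    if A: "A \<in> carrier_mat m m" and U: "U \<in> carrier_mat m m" and V: "V \<in> carrier_mat m m"
    for A U V :: "'a mat"
  proof -
    define k where "k = vec_space.rank m (U * A * V)"
    have UAV: "U * A * V \<in> carrier_mat m m" using A U V by simp
    obtain X Y where X: "X \<in> carrier_mat k m" and Y: "Y \<in> carrier_mat m k"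
      and d: "det (X * (U * A * V) * Y) \<noteq> 0"
      using rank_ge_iff[OF UAV, of k] k_def by blast
    have "X * (U * A * V) * Y = (X * U) * A * (V * Y)" by (rule assoc_mult_mat5[OF X U A V Y])
    with d have "det ((X * U) * A * (V * Y)) \<noteq> 0" by simp
    then show ?thesis
      unfolding k_def[symmetric] using X U V Y by (intro rank_geI[OF A]) auto
  qed
  obtain U' where U': "U' \<in> carrier_mat m m" "U' * U = 1\<^sub>m m"
    using det_non_zero_imp_unit[OF U \<open>det U \<noteq> 0\<close>, of "()"] unfolding Units_def ring_mat_def by auto
  obtain V' where V': "V' \<in> carrier_mat m m" "V * V' = 1\<^sub>m m"
    using det_non_zero_imp_unit[OF V \<open>det V \<noteq> 0\<close>, of "()"] unfolding Units_def ring_mat_def by auto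
  have "U' * (U * A * V) * V' = (U' * U) * A * (V * V')"
    by (rule assoc_mult_mat5[OF U'(1) U A V V'(1)])
  also have "\<dots> = A" using A U' V' by simp
  finally have "vec_space.rank m A \<le> vec_space.rank m (U * A * V)"
    using le[of "U * A * V" U' V'] U' V' A U V by simp
  then show ?thesis using le[OF A U V] by simp
qed

lemma rank_diagonal_mat:
  fixes S :: "'a :: field mat"
  assumes S: "S \<in> carrier_mat m m" and diag: "diagonal_mat S"
  shows "vec_space.rank m S = card {i. i < m \<and> S $$ (i, i) \<noteq> 0}"
proof (rule antisym)
  let ?D = "{i. i < m \<and> S $$ (i, i) \<noteq> 0}"
  have off: "S $$ (i, j) = 0" if "i < m" "j < m" "i \<noteq> j" for i j
    using diag S that by (auto simp: diagonal_mat_def)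
  define k where "k = card ?D"
  obtain h where h: "bij_betw h {..<k} ?D"
    using ex_bij_betw_nat_finite[of ?D] by (auto simp: k_def lessThan_atLeast0)
  have hm: "h l < m" "S $$ (h l, h l) \<noteq> 0" if "l < k" for l
    using bij_betwE[OF h] that by auto
  have inj: "h i = h j \<longleftrightarrow> i = j" if "i < k" "j < k" for i j
    using h that by (auto simp: bij_betw_def inj_on_def)
  have "mat k k (\<lambda>(i, j). S $$ (h i, h j)) = mat k k (\<lambda>(i, j). if i = j then S $$ (h i, h i) else 0)"
    using off hm inj by (intro eq_matI) auto
  moreover have "det (mat k k (\<lambda>(i, j). if i = j then S $$ (h i, h i) else 0))
      = prod_list (diag_mat (mat k k (\<lambda>(i, j). if i = j then S $$ (h i, h i) else 0)))"
    by (rule det_upper_triangular[of _ k]) (auto simp: upper_triangular_def)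
  moreover have "prod_list (diag_mat (mat k k (\<lambda>(i, j). if i = j then S $$ (h i, h i) else 0))) \<noteq> 0"
    using hm by (auto simp: diag_mat_def prod_list_zero_iff)
  ultimately show "card ?D \<le> vec_space.rank m S"
    using hm rank_ge_minor[OF S, of k h h] by (simp add: k_def)
  define B where "B = mat m k (\<lambda>(a, l). S $$ (a, h l))"
  define C where "C = mat k m (\<lambda>(l, b). if b = h l then 1 else 0 :: 'a)"
  have B: "B \<in> carrier_mat m k" and C: "C \<in> carrier_mat k m" by (auto simp: B_def C_def)
  have "S = B * C"
  proof (rule eq_matI)
    fix i j assume "i < dim_row (B * C)" "j < dim_col (B * C)"
    then have ij: "i < m" "j < m" using B C by auto
    have "(B * C) $$ (i, j) = (\<Sum>l<k. S $$ (i, h l) * (if j = h l then 1 else 0))"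
      using ij by (simp add: B_def C_def scalar_prod_def lessThan_atLeast0)
    also have "\<dots> = (\<Sum>e\<in>?D. S $$ (i, e) * (if j = e then 1 else 0))"
      by (rule sum.reindex_bij_betw[OF h])
    also have "\<dots> = (if j \<in> ?D then S $$ (i, j) else 0)"
      by (simp add: if_distrib cong: if_cong)
    also have "\<dots> = S $$ (i, j)" using ij off[of i j] by (cases "i = j") auto
    finally show "S $$ (i, j) = (B * C) $$ (i, j)" by simp
  qed (use S B C in auto)
  then show "vec_space.rank m S \<le> card ?D"
    using rank_mult_le_inner[OF B C] by (simp add: k_def)
qed

lemma not_finite_eigenvalueI:
  assumes P: "P \<in> carrier_mat m m" and rank: "normal_rank m P \<le> vec_space.rank m (eval_mat P \<alpha>)"
  shows "\<not> finite_eigenvalue m P \<alpha>"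
proof
  assume "finite_eigenvalue m P \<alpha>"
  then obtain S i where S: "smith_form m P S" and i: "i < m" "S $$ (i, i) \<noteq> 0" "poly (S $$ (i, i)) \<alpha> = 0"
    by (auto simp: finite_eigenvalue_def invariant_polynomials_def)
  from S obtain U V where Sc: "S \<in> carrier_mat m m" and diag: "diagonal_mat S"
    and U: "U \<in> carrier_mat m m" "unimodular U" and V: "V \<in> carrier_mat m m" "unimodular V"
    and eq: "U * P * V = S"
    by (auto simp: smith_form_def)
  have evS: "eval_mat S \<beta> = eval_mat U \<beta> * eval_mat P \<beta> * eval_mat V \<beta>" for \<beta>
    using U V P
    by (simp add: eq[symmetric] eval_mat_mult[of _ m m _ m])
  have "det (eval_mat U \<beta>) \<noteq> 0" "det (eval_mat V \<beta>) \<noteq> 0" for \<beta>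
    using U(2) V(2) by (auto simp: unimodular_def det_eval_mat)
  then have rk: "vec_space.rank m (eval_mat P \<beta>) = card {i. i < m \<and> poly (S $$ (i, i)) \<beta> \<noteq> 0}" for \<beta>
    using rank_mult_invertible[of "eval_mat P \<beta>" m "eval_mat U \<beta>" "eval_mat V \<beta>"] U V P
      rank_diagonal_mat[of "eval_mat S \<beta>" m] Sc diag
    by (simp add: evS[symmetric] diagonal_mat_def cong: conj_cong)
  define D where "D = {i. i < m \<and> S $$ (i, i) \<noteq> 0}"
  have fin: "finite D" by (simp add: D_def)
  have "(\<Prod>i\<in>D. S $$ (i, i)) \<noteq> 0" using fin by (auto simp: D_def)
  then obtain \<beta> where "poly (\<Prod>i\<in>D. S $$ (i, i)) \<beta> \<noteq> 0"
    using poly_all_0_iff_0 by blast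
  then have "D \<subseteq> {i. i < m \<and> poly (S $$ (i, i)) \<beta> \<noteq> 0}"
    using fin by (auto simp: D_def poly_prod)
  then have "card D \<le> vec_space.rank m (eval_mat P \<beta>)"
    unfolding rk by (intro card_mono) auto
  also have "\<dots> \<le> normal_rank m P" by (rule rank_eval_le_normal_rank[OF P])
  also have "\<dots> \<le> card {i. i < m \<and> poly (S $$ (i, i)) \<alpha> \<noteq> 0}" using rank unfolding rk .
  also have "\<dots> < card D"
    using i fin by (intro psubset_card_mono) (auto simp: D_def)
  finally show False by simp
qed

lemma poly_eq_sum_atMost:
  fixes p :: "'a :: comm_semiring_1 poly"
  assumes "degree p \<le> d"
  shows "poly p x = (\<Sum>k\<le>d. coeff p k * x ^ k)"
proof -
  have "(\<Sum>k\<le>degree p. coeff p k * x ^ k) = (\<Sum>k\<le>d. coeff p k * x ^ k)"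
    using assms by (intro sum.mono_neutral_left) (auto simp: coeff_eq_0)
  then show ?thesis by (simp add: poly_altdef)
qed

lemma normal_rank_rev_pol_le:
  assumes P: "P \<in> carrier_mat m m" and deg: "\<And>i j. i < m \<Longrightarrow> j < m \<Longrightarrow> degree (P $$ (i, j)) \<le> d"
  shows "normal_rank m (rev_pol d P) \<le> normal_rank m P"
proof -
  have R: "rev_pol d P \<in> carrier_mat m m" using P by (simp add: rev_pol_def)
  have "finite (insert 0 {\<alpha>. vec_space.rank m (eval_mat (rev_pol d P) \<alpha>) < normal_rank m (rev_pol d P)})"
    using finite_rank_eval_less[OF R] by simp
  then obtain \<alpha> where a: "\<alpha> \<noteq> 0"
    and rk: "normal_rank m (rev_pol d P) \<le> vec_space.rank m (eval_mat (rev_pol d P) \<alpha>)"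
    using ex_new_if_finite[OF infinite_UNIV_char_0] by (metis (mono_tags, lifting) insertCI mem_Collect_eq not_le)
  have "poly (\<Sum>k\<le>d. monom (coeff p (d - k)) k) \<alpha> = \<alpha> ^ d * poly p (1 / \<alpha>)" if "degree p \<le> d" for p
  proof -
    have "poly (\<Sum>k\<le>d. monom (coeff p (d - k)) k) \<alpha> = (\<Sum>k\<le>d. coeff p (d - k) * \<alpha> ^ k)"
      by (simp add: poly_sum poly_monom)
    also have "\<dots> = (\<Sum>k\<le>d. coeff p k * \<alpha> ^ (d - k))"
      by (rule sum.reindex_bij_witness[of _ "\<lambda>k. d - k" "\<lambda>k. d - k"]) auto
    also have "\<dots> = (\<Sum>k\<le>d. \<alpha> ^ d * (coeff p k * (1 / \<alpha>) ^ k))"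
      using a by (intro sum.cong) (auto simp: power_diff field_simps)
    also have "\<dots> = \<alpha> ^ d * poly p (1 / \<alpha>)"
      using that by (simp add: sum_distrib_left[symmetric] poly_eq_sum_atMost)
    finally show ?thesis .
  qed
  then have "eval_mat (rev_pol d P) \<alpha> = (\<alpha> ^ d \<cdot>\<^sub>m 1\<^sub>m m) * eval_mat P (1 / \<alpha>) * 1\<^sub>m m"
    using P deg by (intro eq_matI) (auto simp: rev_pol_def)
  also have "vec_space.rank m \<dots> = vec_space.rank m (eval_mat P (1 / \<alpha>))"
    using P a by (intro rank_mult_invertible) auto
  also have "\<dots> \<le> normal_rank m P" by (rule rank_eval_le_normal_rank[OF P])
  finally show ?thesis using rk by simp
qed

section \<open>Closedness of the rank condition\<close>

lemma POL_ssD: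
  assumes "P \<in> POL_ss d m"
  shows "P \<in> carrier_mat m m"
    and "\<And>i j. i < m \<Longrightarrow> j < m \<Longrightarrow> degree (P $$ (i, j)) \<le> d"
    and "\<And>i j. i < m \<Longrightarrow> j < m \<Longrightarrow> P $$ (j, i) = - P $$ (i, j)"
proof -
  have zero: "coeff (P $$ (i, j)) k = 0" if "k > d" "i < m" "j < m" for i j k
  proof -
    have "coeff_mat m P k $$ (i, j) = 0\<^sub>m m m $$ (i, j)"
      using assms that by (simp add: POL_ss_def)
    then show ?thesis using that by (simp add: coeff_mat_def)
  qed
  have skew: "coeff (P $$ (j, i)) k = - coeff (P $$ (i, j)) k" if "k \<le> d" "i < m" "j < m" for i j k
  proof -
    have "transpose_mat (coeff_mat m P k) $$ (i, j) = (- coeff_mat m P k) $$ (i, j)"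
      using assms that by (simp add: POL_ss_def)
    then show ?thesis using that by (simp add: coeff_mat_def)
  qed
  show "P \<in> carrier_mat m m" using assms by (simp add: POL_ss_def)
  show "degree (P $$ (i, j)) \<le> d" if "i < m" "j < m" for i j
    using zero that by (intro degree_le) auto
  show "P $$ (j, i) = - P $$ (i, j)" if "i < m" "j < m" for i j
    using zero skew that by (intro poly_eqI) (metis coeff_minus neg_0_equal_iff_equal not_le)
qed

lemma POL_ssI:
  assumes "P \<in> carrier_mat m m"
    and "\<And>i j. i < m \<Longrightarrow> j < m \<Longrightarrow> degree (P $$ (i, j)) \<le> d"
    and "\<And>i j. i < m \<Longrightarrow> j < m \<Longrightarrow> P $$ (j, i) = - P $$ (i, j)"
  shows "P \<in> POL_ss d m"
proof -
  have "coeff (P $$ (i, j)) k = 0" if "k > d" "i < m" "j < m" for i j k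
    using assms(2)[of i j] that by (intro coeff_eq_0) auto
  then have "coeff_mat m P k = 0\<^sub>m m m" if "k > d" for k
    using that by (intro eq_matI) (simp_all add: coeff_mat_def)
  moreover have "transpose_mat (coeff_mat m P k) = - coeff_mat m P k" for k
  proof (rule eq_matI)
    fix i j assume "i < dim_row (- coeff_mat m P k)" "j < dim_col (- coeff_mat m P k)"
    then have "i < m" "j < m" by (simp_all add: coeff_mat_def)
    then show "transpose_mat (coeff_mat m P k) $$ (i, j) = (- coeff_mat m P k) $$ (i, j)"
      using assms(3)[of i j] by (simp add: coeff_mat_def)
  qed (simp_all add: coeff_mat_def)
  ultimately show ?thesis using assms(1) by (simp add: POL_ss_def)
qed

lemma norm_coeff_diff_le_pol_dist:
  assumes "k \<le> d" "i < m" "j < m"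
  shows "cmod (coeff (P $$ (i, j)) k - coeff (Q $$ (i, j)) k) \<le> pol_dist d m P Q"
  unfolding pol_dist_conv_L2_set
  using member_le_L2_set[of "{..d} \<times> {..<m} \<times> {..<m}" "(k, i, j)"
      "\<lambda>(k, i, j). cmod (coeff (P $$ (i, j)) k - coeff (Q $$ (i, j)) k)"] assms by auto

lemma pol_dist_tendsto_0:
  assumes "\<And>i j k. i < m \<Longrightarrow> j < m \<Longrightarrow> (\<lambda>n. coeff (Q n $$ (i, j)) k) \<longlonglongrightarrow> coeff (P $$ (i, j)) k"
  shows "(\<lambda>n. pol_dist d m P (Q n)) \<longlonglongrightarrow> 0"
proof -
  have "(\<lambda>n. sqrt (\<Sum>(k, i, j)\<in>{..d} \<times> {..<m} \<times> {..<m}.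
      (cmod (coeff (P $$ (i, j)) k - coeff (Q n $$ (i, j)) k))\<^sup>2)) \<longlonglongrightarrow>
    sqrt (\<Sum>(k, i, j)\<in>{..d} \<times> {..<m} \<times> {..<m}.
      (cmod (coeff (P $$ (i, j)) k - coeff (P $$ (i, j)) k))\<^sup>2)"
    unfolding case_prod_unfold by (intro tendsto_intros assms) auto
  then show ?thesis
    by (simp add: pol_dist_conv_L2_set L2_set_def case_prod_unfold)
qed

lemma tendsto_det:
  fixes A :: "nat \<Rightarrow> complex mat"
  assumes "\<And>n. A n \<in> carrier_mat k k" "B \<in> carrier_mat k k"
    and "\<And>i j. i < k \<Longrightarrow> j < k \<Longrightarrow> (\<lambda>n. A n $$ (i, j)) \<longlonglongrightarrow> B $$ (i, j)"
  shows "(\<lambda>n. det (A n)) \<longlonglongrightarrow> det B"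
  unfolding det_def'[OF assms(1)] det_def'[OF assms(2)]
proof (intro tendsto_intros)
  fix p i assume "p \<in> {p. p permutes {0..<k}}" "i \<in> {0..<k}"
  then have "i < k" "p i < k" by (auto dest: permutes_in_image)
  then show "(\<lambda>n. A n $$ (i, p i)) \<longlonglongrightarrow> B $$ (i, p i)" by (rule assms(3))
qed

lemma index_triple_mult:
  assumes "X \<in> carrier_mat k n" "A \<in> carrier_mat n m" "Y \<in> carrier_mat m l" "i < k" "j < l"
  shows "(X * A * Y) $$ (i, j) = (\<Sum>b<m. (\<Sum>a<n. X $$ (i, a) * A $$ (a, b)) * Y $$ (b, j))"
proof -
  have "(X * A * Y) $$ (i, j) = (\<Sum>b<m. (X * A) $$ (i, b) * Y $$ (b, j))"
    using assms by (simp add: scalar_prod_def lessThan_atLeast0 del: assoc_mult_mat)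
  also have "\<dots> = (\<Sum>b<m. (\<Sum>a<n. X $$ (i, a) * A $$ (a, b)) * Y $$ (b, j))"
    using assms by (intro sum.cong) (simp_all add: scalar_prod_def lessThan_atLeast0)
  finally show ?thesis .
qed

lemma normal_rank_le_closed:
  assumes P: "P \<in> POL_ss d m"
    and approx: "\<And>e. e > 0 \<Longrightarrow> \<exists>Q\<in>POL_ss d m. normal_rank m Q \<le> \<rho> \<and> pol_dist d m P Q < e"
  shows "normal_rank m P \<le> \<rho>"
proof (rule ccontr)
  note PD = POL_ssD[OF P]
  assume "\<not> normal_rank m P \<le> \<rho>"
  moreover obtain \<alpha> where "normal_rank m P \<le> vec_space.rank m (eval_mat P \<alpha>)"
    using ex_new_if_finite[OF infinite_UNIV_char_0 finite_rank_eval_less[OF PD(1)]] not_le by blast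
  ultimately have "Suc \<rho> \<le> vec_space.rank m (eval_mat P \<alpha>)" by simp
  then obtain X Y where X: "X \<in> carrier_mat (Suc \<rho>) m" and Y: "Y \<in> carrier_mat m (Suc \<rho>)"
    and d: "det (X * eval_mat P \<alpha> * Y) \<noteq> 0"
    using rank_ge_iff[of "eval_mat P \<alpha>" m m "Suc \<rho>"] PD(1) by auto
  have "\<exists>Q. Q \<in> POL_ss d m \<and> normal_rank m Q \<le> \<rho> \<and> pol_dist d m P Q < inverse (real (Suc n))" for n
    using approx[of "inverse (real (Suc n))"] by auto
  then obtain Q where Q: "\<And>n. Q n \<in> POL_ss d m" "\<And>n. normal_rank m (Q n) \<le> \<rho>"
    "\<And>n. pol_dist d m P (Q n) < inverse (real (Suc n))"
    by metis
  have Qc: "Q n \<in> carrier_mat m m" for n using POL_ssD(1)[OF Q(1)] .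
  have coeff: "(\<lambda>n. coeff (Q n $$ (i, j)) k) \<longlonglongrightarrow> coeff (P $$ (i, j)) k"
    if "k \<le> d" "i < m" "j < m" for i j k
  proof (rule LIM_zero_cancel)
    show "(\<lambda>n. coeff (Q n $$ (i, j)) k - coeff (P $$ (i, j)) k) \<longlonglongrightarrow> 0"
    proof (rule Lim_null_comparison[OF _ LIMSEQ_inverse_real_of_nat])
      show "\<forall>\<^sub>F n in sequentially. norm (coeff (Q n $$ (i, j)) k - coeff (P $$ (i, j)) k) \<le> inverse (real (Suc n))"
        using norm_coeff_diff_le_pol_dist[OF that, of P] Q(3)
        by (intro always_eventually) (metis less_eq_real_def norm_minus_commute order_trans)
    qed
  qed
  have ev: "(\<lambda>n. poly (Q n $$ (i, j)) \<alpha>) \<longlonglongrightarrow> poly (P $$ (i, j)) \<alpha>" if "i < m" "j < m" for i j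
    unfolding poly_eq_sum_atMost[OF PD(2)[OF that]] poly_eq_sum_atMost[OF POL_ssD(2)[OF Q(1) that]]
    using that by (intro tendsto_intros coeff) auto
  have evQ: "eval_mat (Q n) \<alpha> $$ (i, j) = poly (Q n $$ (i, j)) \<alpha>" if "i < m" "j < m" for n i j
    using Qc[of n] that by auto
  have "(\<lambda>n. det (X * eval_mat (Q n) \<alpha> * Y)) \<longlonglongrightarrow> det (X * eval_mat P \<alpha> * Y)"
  proof (rule tendsto_det)
    fix i j assume "i < Suc \<rho>" "j < Suc \<rho>"
    then show "(\<lambda>n. (X * eval_mat (Q n) \<alpha> * Y) $$ (i, j)) \<longlonglongrightarrow> (X * eval_mat P \<alpha> * Y) $$ (i, j)"
      using X Y PD(1) Qc by (subst (1 2) index_triple_mult[OF X _ Y]) (auto intro!: tendsto_intros simp: ev evQ)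
  qed (use X Y Qc PD(1) in auto)
  moreover have "det (X * eval_mat (Q n) \<alpha> * Y) = 0" for n
  proof (rule ccontr)
    assume "det (X * eval_mat (Q n) \<alpha> * Y) \<noteq> 0"
    then have "Suc \<rho> \<le> vec_space.rank m (eval_mat (Q n) \<alpha>)"
      using X Y Qc by (intro rank_geI) auto
    also have "\<dots> \<le> \<rho>" using rank_eval_le_normal_rank[OF Qc] Q(2) order_trans by blast
    finally show False by simp
  qed
  ultimately show False using d LIMSEQ_unique[OF tendsto_const] by fastforce
qed

section \<open>Factorizations that are nonsingular on the projective line\<close>

text \<open>Evaluation on the projective line: \<^term>\<open>None\<close> is the point at infinity, and \<open>g\<close> is the
  grade of the polynomial.\<close>

fun ev :: "complex option \<Rightarrow> nat \<Rightarrow> complex poly \<Rightarrow> complex" where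
  "ev None g p = coeff p g"
| "ev (Some \<alpha>) g p = poly p \<alpha>"

lemma ev_0 [simp]: "ev x g 0 = 0" by (cases x) auto
lemma ev_add: "ev x g (p + q) = ev x g p + ev x g q" by (cases x) auto
lemma ev_minus: "ev x g (- p) = - ev x g p" by (cases x) auto
lemma ev_sum: "ev x g (\<Sum>i\<in>I. f i) = (\<Sum>i\<in>I. ev x g (f i))"
  by (cases x) (auto simp: coeff_sum poly_sum)

lemma coeff_mult_top:
  fixes p q :: "'a :: comm_semiring_0 poly"
  assumes "degree p \<le> a" "degree q \<le> b"
  shows "coeff (p * q) (a + b) = coeff p a * coeff q b"
proof -
  have "coeff p i * coeff q (a + b - i) = (if i = a then coeff p a * coeff q b else 0)" for i
  proof (cases i a rule: linorder_cases)
    case less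
    then have "coeff q (a + b - i) = 0" using assms by (intro coeff_eq_0) auto
    then show ?thesis using less by simp
  next
    case greater
    then have "coeff p i = 0" using assms by (intro coeff_eq_0) auto
    then show ?thesis using greater by simp
  qed auto
  then show ?thesis by (simp add: coeff_mult)
qed

lemma ev_mult:
  assumes "degree p \<le> a" "degree q \<le> b"
  shows "ev x (a + b) (p * q) = ev x a p * ev x b q"
  using coeff_mult_top[OF assms] by (cases x) auto

text \<open>A local equation of a point of the projective line, as a polynomial of grade 1.\<close>

fun loc :: "complex option \<Rightarrow> complex poly" where
  "loc None = 1"
| "loc (Some \<alpha>) = [:- \<alpha>, 1:]"

lemma degree_loc_mult_le: "degree (loc x * p) \<le> Suc (degree p)"
  using degree_mult_le[of "loc x" p] by (cases x) auto

lemma finite_loc_roots: "finite {\<beta>. poly (loc x) \<beta> = 0}"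
  by (cases x) auto

lemma ev_eq_0_factor:
  assumes "degree p \<le> g" "p \<noteq> 0" "ev x g p = 0"
  obtains q where "p = loc x * q" "Suc (degree q) \<le> g"
proof (cases x)
  case None
  then have "degree p \<noteq> g" using assms by auto
  then show thesis using that[of p] None assms by simp
next
  case (Some \<alpha>)
  then obtain q where q: "p = [:- \<alpha>, 1:] * q" using assms(3) by (auto simp: poly_eq_0_iff_dvd)
  then have "degree p = Suc (degree q)" using assms(2) by (subst q, subst degree_mult_eq) auto
  then show thesis using that[of q] q Some assms(1) by simp
qed

definition row_indep :: "'i set \<Rightarrow> 'j set \<Rightarrow> ('i \<Rightarrow> 'j \<Rightarrow> complex) \<Rightarrow> bool" where
  "row_indep I J A \<longleftrightarrow> (\<forall>c. (\<forall>j\<in>J. (\<Sum>i\<in>I. c i * A i j) = 0) \<longrightarrow> (\<forall>i\<in>I. c i = 0))"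

lemma row_indepD:
  "row_indep I J A \<Longrightarrow> (\<And>j. j \<in> J \<Longrightarrow> (\<Sum>i\<in>I. c i * A i j) = 0) \<Longrightarrow> i \<in> I \<Longrightarrow> c i = 0"
  by (auto simp: row_indep_def)

lemma row_indep_mono:
  assumes "row_indep I J A" "I' \<subseteq> I" "finite I"
  shows "row_indep I' J A"
  unfolding row_indep_def
proof (intro allI impI ballI)
  fix c i assume c: "\<forall>j\<in>J. (\<Sum>i\<in>I'. c i * A i j) = 0" and i: "i \<in> I'"
  have "(\<Sum>i\<in>I. (if i \<in> I' then c i else 0) * A i j) = (\<Sum>i\<in>I'. c i * A i j)" for j
    using assms(2,3) by (intro sum.mono_neutral_cong_right) auto
  then have "(if i \<in> I' then c i else 0) = 0"
    using c i assms(2) by (intro row_indepD[OF assms(1), where c = "\<lambda>i. if i \<in> I' then c i else 0"]) auto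
  then show "c i = 0" using i by simp
qed

text \<open>
  \<open>P = M\<^sup>T K M\<close> with \<open>\<delta> i\<close> as the grade of row \<open>i\<close> of \<open>M\<close> and \<open>d - \<delta> i - \<delta> j\<close> as that of \<open>K i j\<close>;
  the entry \<open>K i j\<close> vanishes where this would be negative.
\<close>

definition skew_factorization ::
  "nat \<Rightarrow> nat \<Rightarrow> complex poly mat \<Rightarrow> nat set \<Rightarrow> (nat \<Rightarrow> nat) \<Rightarrow>
   (nat \<Rightarrow> nat \<Rightarrow> complex poly) \<Rightarrow> (nat \<Rightarrow> nat \<Rightarrow> complex poly) \<Rightarrow> bool" where
  "skew_factorization d m P I \<delta> M K \<longleftrightarrow>
     finite I \<and> (\<forall>i\<in>I. \<forall>a<m. degree (M i a) \<le> \<delta> i) \<and>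
     (\<forall>i\<in>I. \<forall>j\<in>I. K i j = 0 \<or> degree (K i j) + \<delta> i + \<delta> j \<le> d) \<and>
     (\<forall>i\<in>I. \<forall>j\<in>I. K j i = - K i j) \<and>
     (\<forall>a<m. \<forall>b<m. P $$ (a, b) = (\<Sum>i\<in>I. \<Sum>j\<in>I. M i a * K i j * M j b))"

lemma skew_factorizationD:
  assumes "skew_factorization d m P I \<delta> M K"
  shows "finite I" "\<And>i a. i \<in> I \<Longrightarrow> a < m \<Longrightarrow> degree (M i a) \<le> \<delta> i"
    "\<And>i j. i \<in> I \<Longrightarrow> j \<in> I \<Longrightarrow> K i j = 0 \<or> degree (K i j) + \<delta> i + \<delta> j \<le> d"
    "\<And>i j. i \<in> I \<Longrightarrow> j \<in> I \<Longrightarrow> K j i = - K i j"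
    "\<And>a b. a < m \<Longrightarrow> b < m \<Longrightarrow> P $$ (a, b) = (\<Sum>i\<in>I. \<Sum>j\<in>I. M i a * K i j * M j b)"
  using assms unfolding skew_factorization_def by blast+

definition full_rank_cofinite :: "nat set \<Rightarrow> nat \<Rightarrow> (nat \<Rightarrow> nat \<Rightarrow> complex poly) \<Rightarrow> bool" where
  "full_rank_cofinite I m M \<longleftrightarrow> finite {\<alpha>. \<not> row_indep I {..<m} (\<lambda>i a. poly (M i a) \<alpha>)}"

abbreviation nonsingular_at where
  "nonsingular_at d I \<delta> K x \<equiv> row_indep I I (\<lambda>i j. ev x (d - \<delta> i - \<delta> j) (K i j))"

lemma sum_triple_product:
  fixes A :: "'i \<Rightarrow> 'j \<Rightarrow> 'a :: comm_semiring_0"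
  shows "(\<Sum>i\<in>I. \<Sum>j\<in>J. (\<Sum>k\<in>S. C i k * u k) * A i j * (\<Sum>l\<in>T. D j l * v l))
       = (\<Sum>k\<in>S. \<Sum>l\<in>T. u k * (\<Sum>i\<in>I. \<Sum>j\<in>J. C i k * A i j * D j l) * v l)"
proof -
  have "(\<Sum>i\<in>I. \<Sum>j\<in>J. (\<Sum>k\<in>S. C i k * u k) * A i j * (\<Sum>l\<in>T. D j l * v l))
      = (\<Sum>i\<in>I. \<Sum>j\<in>J. \<Sum>k\<in>S. \<Sum>l\<in>T. u k * (C i k * A i j * D j l) * v l)"
    by (simp add: sum_distrib_left sum_distrib_right mult_ac)
  also have "\<dots> = (\<Sum>i\<in>I. \<Sum>k\<in>S. \<Sum>j\<in>J. \<Sum>l\<in>T. u k * (C i k * A i j * D j l) * v l)"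
    by (intro sum.cong refl sum.swap)
  also have "\<dots> = (\<Sum>k\<in>S. \<Sum>i\<in>I. \<Sum>j\<in>J. \<Sum>l\<in>T. u k * (C i k * A i j * D j l) * v l)"
    by (rule sum.swap)
  also have "\<dots> = (\<Sum>k\<in>S. \<Sum>i\<in>I. \<Sum>l\<in>T. \<Sum>j\<in>J. u k * (C i k * A i j * D j l) * v l)"
    by (intro sum.cong refl sum.swap)
  also have "\<dots> = (\<Sum>k\<in>S. \<Sum>l\<in>T. \<Sum>i\<in>I. \<Sum>j\<in>J. u k * (C i k * A i j * D j l) * v l)"
    by (intro sum.cong refl sum.swap)
  also have "\<dots> = (\<Sum>k\<in>S. \<Sum>l\<in>T. u k * (\<Sum>i\<in>I. \<Sum>j\<in>J. C i k * A i j * D j l) * v l)"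
    by (simp add: sum_distrib_left sum_distrib_right)
  finally show ?thesis .
qed

text \<open>
  A vector \<open>c\<close> in the kernel of \<open>K\<close> at \<open>x\<close> moves a factor from \<open>K\<close> to \<open>M\<close>. Homogenized to \<open>\<gamma>\<close>, it
  is the column \<open>p\<close> of a change of basis, where \<open>p\<close> has the smallest row grade in the support of
  \<open>c\<close>, so that all grades are respected. After it the row and column \<open>p\<close> of \<open>K\<close> vanish at \<open>x\<close>, and
  their local factor goes to the row \<open>p\<close> of \<open>M\<close>.
\<close>

lemma skew_factorization_raise:
  assumes F: "skew_factorization d m P I \<delta> M K" and fr: "full_rank_cofinite I m M"
    and sing: "\<not> nonsingular_at d I \<delta> K x"
  shows "\<exists>p\<in>I. \<exists>M' K'. skew_factorization d m P I (\<delta>(p := Suc (\<delta> p))) M' K' \<and> full_rank_cofinite I m M'"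
proof -
  note fin = skew_factorizationD(1)[OF F] and degM = skew_factorizationD(2)[OF F]
    and degK = skew_factorizationD(3)[OF F] and skewK = skew_factorizationD(4)[OF F]
    and P = skew_factorizationD(5)[OF F]
  obtain c where c: "\<And>j. j \<in> I \<Longrightarrow> (\<Sum>i\<in>I. c i * ev x (d - \<delta> i - \<delta> j) (K i j)) = 0"
    and c0: "\<exists>i\<in>I. c i \<noteq> 0"
    using sing by (auto simp: row_indep_def)
  define T where "T = {i \<in> I. c i \<noteq> 0}"
  have T: "finite T" "T \<noteq> {}" using fin c0 by (auto simp: T_def)
  obtain p where pT: "p \<in> T" and pmin: "\<And>i. i \<in> T \<Longrightarrow> \<delta> p \<le> \<delta> i"
    using ex_min_if_finite[of "\<delta> ` T"] T by (metis (no_types, lifting) arg_min_if_finite(1) arg_min_least)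
  have p: "p \<in> I" "c p \<noteq> 0" using pT by (auto simp: T_def)
  define \<gamma> where "\<gamma> i = (if c i = 0 then 0 else monom (c i / c p) (if x = None then \<delta> i - \<delta> p else 0))" for i
  have gp: "\<gamma> p = 1" using p by (simp add: \<gamma>_def monom_0)
  have gdeg: "\<gamma> i = 0 \<or> degree (\<gamma> i) + \<delta> p \<le> \<delta> i" if "i \<in> I" for i
    using pmin[of i] that degree_monom_le[of "c i / c p"]
    by (auto simp: \<gamma>_def T_def intro!: order_trans[OF add_right_mono[OF degree_monom_le]])
  have gev: "ev x (\<delta> i - \<delta> p) (\<gamma> i) = c i / c p" for i
    by (cases x) (auto simp: \<gamma>_def poly_monom)
  define C where "C i k = (if k = p then \<gamma> i else if i = k then 1 else 0)" for i k
  have Cdeg: "C i k = 0 \<or> degree (C i k) + \<delta> k \<le> \<delta> i" if "i \<in> I" for i k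
    using gdeg[OF that] by (auto simp: C_def)
  define M1 where "M1 i a = (if i = p then M p a else M i a - \<gamma> i * M p a)" for i a
  define K1 where "K1 k l = (\<Sum>i\<in>I. \<Sum>j\<in>I. C i k * K i j * C j l)" for k l
  have MC: "M i a = (\<Sum>k\<in>I. C i k * M1 k a)" if i: "i \<in> I" for i a
  proof -
    have "(\<Sum>k\<in>I. C i k * M1 k a) = C i p * M1 p a + (\<Sum>k\<in>I - {p}. C i k * M1 k a)"
      using fin p by (simp add: sum.remove)
    also have "(\<Sum>k\<in>I - {p}. C i k * M1 k a) = (\<Sum>k\<in>I - {p}. if k = i then M1 k a else 0)"
      by (intro sum.cong) (auto simp: C_def)
    also have "\<dots> = (if i = p then 0 else M1 i a)" using fin i by (simp add: sum.delta)
    finally show ?thesis using gp by (auto simp: C_def M1_def)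
  qed
  have P1: "P $$ (a, b) = (\<Sum>k\<in>I. \<Sum>l\<in>I. M1 k a * K1 k l * M1 l b)" if "a < m" "b < m" for a b
  proof -
    have "P $$ (a, b) = (\<Sum>i\<in>I. \<Sum>j\<in>I. (\<Sum>k\<in>I. C i k * M1 k a) * K i j * (\<Sum>l\<in>I. C j l * M1 l b))"
      unfolding P[OF that] by (intro sum.cong refl) (simp add: MC[symmetric])
    then show ?thesis unfolding sum_triple_product K1_def .
  qed
  have skew1: "K1 l k = - K1 k l" for k l
  proof -
    have "K1 l k = (\<Sum>j\<in>I. \<Sum>i\<in>I. C i l * K i j * C j k)"
      unfolding K1_def by (rule sum.swap)
    also have "\<dots> = (\<Sum>j\<in>I. \<Sum>i\<in>I. - (C j k * K j i * C i l))"
    proof (intro sum.cong refl)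
      fix i j assume "i \<in> I" "j \<in> I"
      then have "K i j = - K j i" by (rule skewK[rotated])
      then show "C i l * K i j * C j k = - (C j k * K j i * C i l)" by (simp add: mult_ac)
    qed
    finally show ?thesis by (simp add: K1_def sum_negf)
  qed
  have trm: "C i k * K i j * C j l = 0 \<or>
      (degree (C i k) + \<delta> k \<le> \<delta> i \<and> degree (K i j) + \<delta> i + \<delta> j \<le> d \<and> degree (C j l) + \<delta> l \<le> \<delta> j)"
    if "i \<in> I" "j \<in> I" for i j k l
    using Cdeg[OF that(1), of k] Cdeg[OF that(2), of l] degK[OF that] by auto
  have trm_le: "degree (C i k * K i j * C j l) \<le> d - \<delta> k - \<delta> l"
    and trm_0: "d < \<delta> k + \<delta> l \<Longrightarrow> C i k * K i j * C j l = 0"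
    if "i \<in> I" "j \<in> I" for i j k l
  proof -
    have "degree (C i k * K i j * C j l) \<le> degree (C i k) + degree (K i j) + degree (C j l)"
      using degree_mult_le[of "C i k * K i j" "C j l"] degree_mult_le[of "C i k" "K i j"] by linarith
    then show "degree (C i k * K i j * C j l) \<le> d - \<delta> k - \<delta> l"
      using trm[OF that, of k l] by auto
    show "C i k * K i j * C j l = 0" if "d < \<delta> k + \<delta> l"
      using trm[OF \<open>i \<in> I\<close> \<open>j \<in> I\<close>, of k l] that by linarith
  qed
  have deg1: "K1 k l = 0 \<or> degree (K1 k l) + \<delta> k + \<delta> l \<le> d" for k l
  proof (cases "d < \<delta> k + \<delta> l")
    case True
    then show ?thesis using trm_0 by (simp add: K1_def)
  next
    case False
    have "degree (K1 k l) \<le> d - \<delta> k - \<delta> l"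
      unfolding K1_def using fin trm_le by (intro degree_sum_le) auto
    then show ?thesis using False by linarith
  qed
  have trm_ev: "ev x (d - \<delta> k - \<delta> l) (C i k * K i j * C j l) =
      ev x (\<delta> i - \<delta> k) (C i k) * ev x (d - \<delta> i - \<delta> j) (K i j) * ev x (\<delta> j - \<delta> l) (C j l)"
    if ij: "i \<in> I" "j \<in> I" for i j k l
  proof (cases "C i k = 0 \<or> K i j = 0 \<or> C j l = 0")
    case False
    then have le: "degree (C i k) + \<delta> k \<le> \<delta> i" "degree (K i j) + \<delta> i + \<delta> j \<le> d" "degree (C j l) + \<delta> l \<le> \<delta> j"
      using trm[OF ij, of k l] by auto
    then have eq: "d - \<delta> k - \<delta> l = ((\<delta> i - \<delta> k) + (d - \<delta> i - \<delta> j)) + (\<delta> j - \<delta> l)" by auto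
    have "degree (C i k * K i j) \<le> (\<delta> i - \<delta> k) + (d - \<delta> i - \<delta> j)"
      using degree_mult_le[of "C i k" "K i j"] le by auto
    then show ?thesis unfolding eq using le by (subst ev_mult | simp)+
  qed auto
  have Cp: "C i p = \<gamma> i" for i by (simp add: C_def)
  have ev1: "ev x (d - \<delta> p - \<delta> l) (K1 p l) = 0" for l
  proof -
    have "ev x (d - \<delta> p - \<delta> l) (K1 p l)
        = (\<Sum>i\<in>I. \<Sum>j\<in>I. c i / c p * ev x (d - \<delta> i - \<delta> j) (K i j) * ev x (\<delta> j - \<delta> l) (C j l))"
      unfolding K1_def ev_sum
      by (intro sum.cong refl) (simp only: trm_ev[where k = p, unfolded Cp gev] Cp)
    also have "\<dots> = (\<Sum>j\<in>I. \<Sum>i\<in>I. c i / c p * ev x (d - \<delta> i - \<delta> j) (K i j) * ev x (\<delta> j - \<delta> l) (C j l))"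
      by (rule sum.swap)
    also have "\<dots> = (\<Sum>j\<in>I. (\<Sum>i\<in>I. c i * ev x (d - \<delta> i - \<delta> j) (K i j)) / c p * ev x (\<delta> j - \<delta> l) (C j l))"
      by (simp add: sum_distrib_right sum_divide_distrib)
    also have "\<dots> = 0" using c by (intro sum.neutral) simp
    finally show ?thesis .
  qed
  have "\<exists>q. K1 p l = loc x * q \<and> (q = 0 \<or> degree q + Suc (\<delta> p) + \<delta> l \<le> d)" for l
  proof (cases "K1 p l = 0")
    case False
    then have le: "degree (K1 p l) + \<delta> p + \<delta> l \<le> d" using deg1 by blast
    then have "degree (K1 p l) \<le> d - \<delta> p - \<delta> l" by simp
    from ev_eq_0_factor[OF this False ev1] obtain q
      where "K1 p l = loc x * q" "Suc (degree q) \<le> d - \<delta> p - \<delta> l" by blast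
    then show ?thesis by (intro exI[of _ q]) auto
  qed (intro exI[of _ 0], simp)
  then obtain Q where Q: "\<And>l. K1 p l = loc x * Q l"
    and Qdeg: "\<And>l. Q l = 0 \<or> degree (Q l) + Suc (\<delta> p) + \<delta> l \<le> d" by metis
  have K1pp: "K1 p p = 0"
  proof -
    have "K1 p p + K1 p p = 0" using skew1[of p p] by (metis add.right_inverse)
    then have "2 * K1 p p = 0" by (simp only: mult_2)
    then show ?thesis by simp
  qed
  define \<delta>' where "\<delta>' = \<delta>(p := Suc (\<delta> p))"
  define M2 where "M2 k a = (if k = p then loc x * M1 p a else M1 k a)" for k a
  define K2 where "K2 k l = (if k = p then if l = p then 0 else Q l else if l = p then - Q k else K1 k l)" for k l
  have "M2 k a * K2 k l * M2 l b = M1 k a * K1 k l * M1 l b" for k l a b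
    using Q[of l] Q[of k] skew1[of k p] K1pp by (auto simp: M2_def K2_def mult_ac)
  then have "P $$ (a, b) = (\<Sum>k\<in>I. \<Sum>l\<in>I. M2 k a * K2 k l * M2 l b)" if "a < m" "b < m" for a b
    using P1[OF that] by simp
  moreover have "degree (M2 i a) \<le> \<delta>' i" if "i \<in> I" "a < m" for i a
  proof (cases "i = p")
    case True
    then show ?thesis
      using degree_loc_mult_le[of x "M p a"] degM[OF p(1) that(2)] by (simp add: M2_def M1_def \<delta>'_def)
  next
    case False
    have "degree (\<gamma> i * M p a) \<le> \<delta> i"
      using gdeg[OF that(1)] degree_mult_le[of "\<gamma> i" "M p a"] degM[OF p(1) that(2)] by auto
    then show ?thesis
      using False degM[OF that] degree_diff_le[of "M i a" "\<delta> i" "\<gamma> i * M p a"]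
      by (simp add: M2_def M1_def \<delta>'_def)
  qed
  moreover have "K2 k l = 0 \<or> degree (K2 k l) + \<delta>' k + \<delta>' l \<le> d" for k l
  proof -
    consider "k = p" "l = p" | "k = p" "l \<noteq> p" | "k \<noteq> p" "l = p" | "k \<noteq> p" "l \<noteq> p" by blast
    then show ?thesis
    proof cases
      case 2
      then show ?thesis using Qdeg[of l] by (simp add: K2_def \<delta>'_def)
    next
      case 3
      then show ?thesis using Qdeg[of k] by (auto simp: K2_def \<delta>'_def)
    next
      case 4
      then show ?thesis using deg1[of k l] by (simp add: K2_def \<delta>'_def)
    qed (simp add: K2_def)
  qed
  moreover have "K2 l k = - K2 k l" for k l
    using skew1[where k = k and l = l] by (simp add: K2_def)
  ultimately have F2: "skew_factorization d m P I \<delta>' M2 K2"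
    using fin unfolding skew_factorization_def by blast
  have "row_indep I {..<m} (\<lambda>i a. poly (M2 i a) \<beta>)"
    if ri: "row_indep I {..<m} (\<lambda>i a. poly (M i a) \<beta>)" and b: "poly (loc x) \<beta> \<noteq> 0" for \<beta>
    unfolding row_indep_def
  proof (intro allI impI ballI)
    fix e i assume e: "\<forall>a\<in>{..<m}. (\<Sum>i\<in>I. e i * poly (M2 i a) \<beta>) = 0" and i: "i \<in> I"
    define e' where "e' k = (if k = p then poly (loc x) \<beta> * e p else e k)" for k
    define f where "f k = (if k = p then e' p - (\<Sum>k\<in>I - {p}. e' k * poly (\<gamma> k) \<beta>) else e' k)" for k
    have f0: "f k = 0" if "k \<in> I" for k
    proof (rule row_indepD[OF ri _ that])
      fix a assume a: "a \<in> {..<m}"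
      have "(\<Sum>i\<in>I. f i * poly (M i a) \<beta>) = f p * poly (M p a) \<beta> + (\<Sum>i\<in>I - {p}. f i * poly (M i a) \<beta>)"
        using fin p by (simp add: sum.remove)
      also have "\<dots> = e' p * poly (M p a) \<beta> + (\<Sum>i\<in>I - {p}. e' i * (poly (M i a) \<beta> - poly (\<gamma> i) \<beta> * poly (M p a) \<beta>))"
        by (simp add: f_def algebra_simps sum_distrib_left sum_distrib_right sum_subtractf)
      also have "\<dots> = e p * poly (M2 p a) \<beta> + (\<Sum>i\<in>I - {p}. e i * poly (M2 i a) \<beta>)"
        by (simp add: e'_def M2_def M1_def mult_ac)
      also have "\<dots> = (\<Sum>i\<in>I. e i * poly (M2 i a) \<beta>)" using fin p by (simp add: sum.remove)
      finally show "(\<Sum>i\<in>I. f i * poly (M i a) \<beta>) = 0" using e a by simp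
    qed
    then have e'0: "e' k = 0" if "k \<in> I - {p}" for k using that f0[of k] by (simp add: f_def)
    then have "(\<Sum>k\<in>I - {p}. e' k * poly (\<gamma> k) \<beta>) = 0" by (intro sum.neutral) auto
    then have "e' p = 0" using f0[OF p(1)] by (simp add: f_def)
    then show "e i = 0" using e'0[of i] i b by (auto simp: e'_def split: if_splits)
  qed
  then have "{\<beta>. \<not> row_indep I {..<m} (\<lambda>i a. poly (M2 i a) \<beta>)}
      \<subseteq> {\<beta>. \<not> row_indep I {..<m} (\<lambda>i a. poly (M i a) \<beta>)} \<union> {\<beta>. poly (loc x) \<beta> = 0}" by blast
  then have "full_rank_cofinite I m M2"
    using fr finite_loc_roots[of x] unfolding full_rank_cofinite_def
    by (meson finite_UnI finite_subset)
  with F2 show ?thesis unfolding \<delta>'_def using p(1) by blast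
qed

lemma skew_factorization_delete:
  assumes F: "skew_factorization d m P I \<delta> M K" and fr: "full_rank_cofinite I m M"
    and p: "p \<in> I" "d < \<delta> p"
  shows "skew_factorization d m P (I - {p}) \<delta> M K" "full_rank_cofinite (I - {p}) m M"
proof -
  have fin: "finite I" using F by (simp add: skew_factorization_def)
  have z: "K p j = 0" "K j p = 0" if "j \<in> I" for j
    using skew_factorizationD(3)[OF F p(1) that] skew_factorizationD(3)[OF F that p(1)] p(2) by auto
  have "(\<Sum>i\<in>I. \<Sum>j\<in>I. M i a * K i j * M j b) = (\<Sum>i\<in>I - {p}. \<Sum>j\<in>I - {p}. M i a * K i j * M j b)" for a b
    using fin p z by (simp add: sum.remove[of I p])
  then have "P $$ (a, b) = (\<Sum>i\<in>I - {p}. \<Sum>j\<in>I - {p}. M i a * K i j * M j b)" if "a < m" "b < m" for a b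
    using skew_factorizationD(5)[OF F that] by simp
  then show "skew_factorization d m P (I - {p}) \<delta> M K"
    using F unfolding skew_factorization_def by blast
  have "{\<alpha>. \<not> row_indep (I - {p}) {..<m} (\<lambda>i a. poly (M i a) \<alpha>)} \<subseteq> {\<alpha>. \<not> row_indep I {..<m} (\<lambda>i a. poly (M i a) \<alpha>)}"
    using row_indep_mono[of I _ _ "I - {p}"] fin by blast
  then show "full_rank_cofinite (I - {p}) m M"
    using fr finite_subset unfolding full_rank_cofinite_def by blast
qed

text \<open>
  If \<open>K\<close> is singular everywhere, raising row grades forever makes some \<open>\<delta> p\<close> exceed \<open>d\<close>; then the
  row and column \<open>p\<close> of \<open>K\<close> are zero and can be deleted.
\<close>

lemma skew_factorization_nonsingular:
  assumes "skew_factorization d m P I \<delta> M K" "full_rank_cofinite I m M" "\<And>i. i \<in> I \<Longrightarrow> \<delta> i \<le> Suc d"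
  shows "\<exists>I' \<delta>' M' K'. skew_factorization d m P I' \<delta>' M' K' \<and> full_rank_cofinite I' m M' \<and>
    (\<forall>x. nonsingular_at d I' \<delta>' K' x)"
  using assms
proof (induction "\<Sum>i\<in>I. d + 2 - \<delta> i" arbitrary: I \<delta> M K rule: less_induct)
  case less
  have fin: "finite I" using less.prems(1) by (simp add: skew_factorization_def)
  show ?case
  proof (cases "\<exists>p\<in>I. d < \<delta> p")
    case True
    then obtain p where p: "p \<in> I" "d < \<delta> p" by blast
    show ?thesis
    proof (rule less.hyps[OF _ skew_factorization_delete[OF less.prems(1,2) p]])
      show "(\<Sum>i\<in>I - {p}. d + 2 - \<delta> i) < (\<Sum>i\<in>I. d + 2 - \<delta> i)"
        using less.prems(3)[OF p(1)] p fin by (simp add: sum.remove[of I p])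
    qed (use less.prems(3) in auto)
  next
    case False
    show ?thesis
    proof (cases "\<forall>x. nonsingular_at d I \<delta> K x")
      case True
      then show ?thesis using less.prems by blast
    next
      case sing: False
      then obtain x where "\<not> nonsingular_at d I \<delta> K x" by blast
      from skew_factorization_raise[OF less.prems(1,2) this] obtain p M' K' where p: "p \<in> I"
        and F': "skew_factorization d m P I (\<delta>(p := Suc (\<delta> p))) M' K'" "full_rank_cofinite I m M'"
        by blast
      have pd: "\<delta> p \<le> d" using False p by auto
      show ?thesis
      proof (rule less.hyps[OF _ F'])
        have "(\<Sum>i\<in>I - {p}. d + 2 - (\<delta>(p := Suc (\<delta> p))) i) = (\<Sum>i\<in>I - {p}. d + 2 - \<delta> i)"
          by (intro sum.cong) auto
        then show "(\<Sum>i\<in>I. d + 2 - (\<delta>(p := Suc (\<delta> p))) i) < (\<Sum>i\<in>I. d + 2 - \<delta> i)"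
          using p pd fin by (simp add: sum.remove[of I p])
      qed (use less.prems(3) pd in auto)
    qed
  qed
qed

lemma row_indep_reindex:
  assumes A: "row_indep I J A" and h: "bij_betw h I' I" and g: "J \<subseteq> g ` J'"
  shows "row_indep I' J' (\<lambda>i j. A (h i) (g j))"
  unfolding row_indep_def
proof (intro allI impI ballI)
  fix c i assume c: "\<forall>j\<in>J'. (\<Sum>i\<in>I'. c i * A (h i) (g j)) = 0" and i: "i \<in> I'"
  have inv: "inv_into I' h (h i) = i" if "i \<in> I'" for i
    using h that by (auto simp: bij_betw_def)
  have "(\<Sum>i\<in>I. c (inv_into I' h i) * A i j) = (\<Sum>i\<in>I'. c i * A (h i) j)" for j
    unfolding sum.reindex_bij_betw[OF h, symmetric] by (intro sum.cong) (auto simp: inv)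
  then have "c (inv_into I' h (h i)) = 0"
    using c g i bij_betwE[OF h]
    by (intro row_indepD[OF A, where c = "\<lambda>i. c (inv_into I' h i)"]) auto
  then show "c i = 0" using inv i by simp
qed

lemma row_indep_iff_det:
  fixes n :: nat
  shows "row_indep {..<n} {..<n} A \<longleftrightarrow> det (mat n n (\<lambda>(i, j). A i j)) \<noteq> 0"
proof -
  let ?B = "mat n n (\<lambda>(i, j). A i j)"
  have idx: "(transpose_mat ?B *\<^sub>v v) $ j = (\<Sum>i<n. v $ i * A i j)" if "j < n" "v \<in> carrier_vec n" for v j
    using that by (simp add: scalar_prod_def lessThan_atLeast0 mult.commute)
  have "det ?B = 0 \<longleftrightarrow> det (transpose_mat ?B) = 0" using det_transpose[of ?B n] by simp
  also have "\<dots> \<longleftrightarrow> (\<exists>v. v \<in> carrier_vec n \<and> v \<noteq> 0\<^sub>v n \<and> transpose_mat ?B *\<^sub>v v = 0\<^sub>v n)"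
    by (intro det_0_iff_vec_prod_zero) simp
  also have "\<dots> \<longleftrightarrow> (\<exists>v. v \<in> carrier_vec n \<and> v \<noteq> 0\<^sub>v n \<and> (\<forall>j<n. (\<Sum>i<n. v $ i * A i j) = 0))"
  proof (intro ex_cong1 conj_cong refl)
    fix v :: "complex vec" assume v: "v \<in> carrier_vec n"
    have "transpose_mat ?B *\<^sub>v v = 0\<^sub>v n \<longleftrightarrow> (\<forall>j<n. (transpose_mat ?B *\<^sub>v v) $ j = 0)"
      by (auto simp: vec_eq_iff)
    then show "transpose_mat ?B *\<^sub>v v = 0\<^sub>v n \<longleftrightarrow> (\<forall>j<n. (\<Sum>i<n. v $ i * A i j) = 0)"
      using idx[OF _ v] by simp
  qed
  also have "\<dots> \<longleftrightarrow> \<not> row_indep {..<n} {..<n} A"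
  proof
    assume "\<exists>v. v \<in> carrier_vec n \<and> v \<noteq> 0\<^sub>v n \<and> (\<forall>j<n. (\<Sum>i<n. v $ i * A i j) = 0)"
    then obtain v :: "complex vec"
      where v: "v \<in> carrier_vec n" "v \<noteq> 0\<^sub>v n" "\<forall>j<n. (\<Sum>i<n. v $ i * A i j) = 0" by blast
    then obtain i where "i < n" "v $ i \<noteq> 0" by (auto simp: vec_eq_iff)
    then show "\<not> row_indep {..<n} {..<n} A" using v(3) by (auto simp: row_indep_def)
  next
    assume "\<not> row_indep {..<n} {..<n} A"
    then obtain c i where c: "\<forall>j<n. (\<Sum>i<n. c i * A i j) = 0" "i < n" "c i \<noteq> 0"
      by (auto simp: row_indep_def)
    then show "\<exists>v. v \<in> carrier_vec n \<and> v \<noteq> 0\<^sub>v n \<and> (\<forall>j<n. (\<Sum>i<n. v $ i * A i j) = 0)"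
      by (intro exI[of _ "vec n c"]) (auto simp: vec_eq_iff)
  qed
  finally show ?thesis by blast
qed

lemma row_indep_gram:
  assumes R: "row_indep I J R" and fin: "finite J"
  shows "row_indep I I (\<lambda>i j. \<Sum>a\<in>J. R i a * cnj (R j a))"
  unfolding row_indep_def
proof (intro allI impI)
  fix c assume c: "\<forall>j\<in>I. (\<Sum>i\<in>I. c i * (\<Sum>a\<in>J. R i a * cnj (R j a))) = 0"
  define s where "s a = (\<Sum>i\<in>I. c i * R i a)" for a
  have "(\<Sum>a\<in>J. s a * cnj (s a)) = (\<Sum>a\<in>J. \<Sum>j\<in>I. \<Sum>i\<in>I. cnj (c j) * (c i * (R i a * cnj (R j a))))"
    by (simp add: s_def sum_distrib_left sum_distrib_right mult_ac)
  also have "\<dots> = (\<Sum>j\<in>I. \<Sum>a\<in>J. \<Sum>i\<in>I. cnj (c j) * (c i * (R i a * cnj (R j a))))"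
    by (rule sum.swap)
  also have "\<dots> = (\<Sum>j\<in>I. \<Sum>i\<in>I. \<Sum>a\<in>J. cnj (c j) * (c i * (R i a * cnj (R j a))))"
    by (intro sum.cong refl sum.swap)
  also have "\<dots> = (\<Sum>j\<in>I. cnj (c j) * (\<Sum>i\<in>I. c i * (\<Sum>a\<in>J. R i a * cnj (R j a))))"
    by (simp add: sum_distrib_left)
  also have "\<dots> = 0" using c by (intro sum.neutral) simp
  finally have "(\<Sum>a\<in>J. s a * cnj (s a)) = 0" .
  moreover have "(\<Sum>a\<in>J. s a * cnj (s a)) = of_real (\<Sum>a\<in>J. (cmod (s a))\<^sup>2)"
    by (simp add: complex_norm_square del: of_real_power)
  ultimately have "(\<Sum>a\<in>J. (cmod (s a))\<^sup>2) = 0" by (metis of_real_eq_0_iff)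
  then have "s a = 0" if "a \<in> J" for a
    using that fin by (simp add: sum_nonneg_eq_0_iff)
  then show "\<forall>i\<in>I. c i = 0" using row_indepD[OF R] by (simp add: s_def)
qed

lemma rank_congruence:
  assumes R: "row_indep {..<n} {..<m} R" and K: "row_indep {..<n} {..<n} K"
    and A: "A \<in> carrier_mat m m"
    and eq: "\<And>a b. a < m \<Longrightarrow> b < m \<Longrightarrow> A $$ (a, b) = (\<Sum>i<n. \<Sum>j<n. R i a * K i j * R j b)"
  shows "n \<le> vec_space.rank m A"
proof -
  define RR where "RR = mat n m (\<lambda>(i, a). R i a)"
  define KK where "KK = mat n n (\<lambda>(i, j). K i j)"
  define Y where "Y = mat m n (\<lambda>(a, j). cnj (R j a))"
  have c: "RR \<in> carrier_mat n m" "KK \<in> carrier_mat n n" "Y \<in> carrier_mat m n"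
    by (simp_all add: RR_def KK_def Y_def)
  have AK: "A = transpose_mat RR * KK * RR"
  proof (rule eq_matI)
    fix a b assume "a < dim_row (transpose_mat RR * KK * RR)" "b < dim_col (transpose_mat RR * KK * RR)"
    then have ab: "a < m" "b < m" using c by auto
    have "(transpose_mat RR * KK * RR) $$ (a, b) =
        (\<Sum>j<n. (\<Sum>i<n. transpose_mat RR $$ (a, i) * KK $$ (i, j)) * RR $$ (j, b))"
      using c ab by (intro index_triple_mult) auto
    also have "\<dots> = (\<Sum>j<n. \<Sum>i<n. R i a * K i j * R j b)"
      using ab by (simp add: RR_def KK_def sum_distrib_right)
    also have "\<dots> = (\<Sum>i<n. \<Sum>j<n. R i a * K i j * R j b)" by (rule sum.swap)
    finally show "A $$ (a, b) = (transpose_mat RR * KK * RR) $$ (a, b)" using eq[OF ab] by simp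
  qed (use A c in auto)
  have "RR * Y = mat n n (\<lambda>(i, j). \<Sum>a<m. R i a * cnj (R j a))"
    by (intro eq_matI) (auto simp: RR_def Y_def scalar_prod_def lessThan_atLeast0)
  then have G: "det (RR * Y) \<noteq> 0"
    using row_indep_gram[OF R] row_indep_iff_det[of n] by simp
  have "transpose_mat Y * A * Y = (transpose_mat Y * transpose_mat RR) * KK * (RR * Y)"
    unfolding AK using c by (intro assoc_mult_mat5) auto
  also have "transpose_mat Y * transpose_mat RR = transpose_mat (RR * Y)"
    using c by (simp add: transpose_mult)
  also have "det (transpose_mat (RR * Y) * KK * (RR * Y)) = det (transpose_mat (RR * Y)) * det KK * det (RR * Y)"
    using c det_mult[of "transpose_mat (RR * Y)" n KK] det_mult[of "transpose_mat (RR * Y) * KK" n "RR * Y"] by simp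
  also have "\<dots> \<noteq> 0"
    using G K c det_transpose[of "RR * Y" n] by (simp add: row_indep_iff_det KK_def)
  finally show ?thesis using c by (intro rank_geI[OF A, of "transpose_mat Y" n Y]) auto
qed

lemma even_dim_if_skew_nonsingular:
  fixes n :: nat
  assumes A: "row_indep {..<n} {..<n} A" and skew: "\<And>i j. i < n \<Longrightarrow> j < n \<Longrightarrow> A j i = - A i j"
  shows "even n"
proof (rule ccontr)
  assume odd: "odd n"
  let ?B = "mat n n (\<lambda>(i, j). A i j)"
  have "transpose_mat ?B = (- 1) \<cdot>\<^sub>m ?B"
  proof (rule eq_matI)
    fix i j assume "i < dim_row ((- 1) \<cdot>\<^sub>m ?B)" "j < dim_col ((- 1) \<cdot>\<^sub>m ?B)"
    then show "transpose_mat ?B $$ (i, j) = ((- 1) \<cdot>\<^sub>m ?B) $$ (i, j)"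
      using skew[of i j] by simp
  qed auto
  then have "det ?B = - det ?B"
    using det_transpose[of ?B n] odd by simp
  then show False using A by (simp add: row_indep_iff_det)
qed

lemma skew_factorization_reindex:
  assumes F: "skew_factorization d m P I \<delta> M K" and h: "bij_betw h {..<n} I"
  shows "skew_factorization d m P {..<n} (\<lambda>i. \<delta> (h i)) (\<lambda>i. M (h i)) (\<lambda>i j. K (h i) (h j))"
proof -
  have hI: "h i \<in> I" if "i < n" for i using bij_betwE[OF h] that by simp
  have "P $$ (a, b) = (\<Sum>i<n. \<Sum>j<n. M (h i) a * K (h i) (h j) * M (h j) b)" if "a < m" "b < m" for a b
    unfolding skew_factorizationD(5)[OF F that] sum.reindex_bij_betw[OF h, symmetric] ..
  then show ?thesis
    using F hI unfolding skew_factorization_def by blast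
qed

lemma skew_factorization_pad:
  assumes F: "skew_factorization d m P {..<n} \<delta> M K" and ns: "\<And>x. nonsingular_at d {..<n} \<delta> K x"
  shows "\<exists>\<delta>' M' K'. skew_factorization d m P {..<n + 2} \<delta>' M' K' \<and> (\<forall>x. nonsingular_at d {..<n + 2} \<delta>' K' x)"
proof -
  define \<delta>' where "\<delta>' = \<delta>(n := 0, n + 1 := d)"
  define M' where "M' i a = (if i < n then M i a else 0)" for i a
  define K' where "K' i j = (if i < n \<and> j < n then K i j else if i = n \<and> j = n + 1 then 1
    else if i = n + 1 \<and> j = n then - 1 else 0)" for i j
  note D = skew_factorizationD[OF F]
  have two: "{..<n + 2} = insert n (insert (n + 1) {..<n})" by auto
  have lt: "i < n + 2 \<longleftrightarrow> i < n \<or> i = n \<or> i = n + 1" for i by auto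
  have "degree (M' i a) \<le> \<delta>' i" if "i < n + 2" "a < m" for i a
    using D(2)[of i a] that by (simp add: M'_def \<delta>'_def)
  moreover have "K' i j = 0 \<or> degree (K' i j) + \<delta>' i + \<delta>' j \<le> d" for i j
    using D(3)[of i j] by (auto simp: K'_def \<delta>'_def)
  moreover have "K' j i = - K' i j" for i j
    using D(4)[of i j] by (auto simp: K'_def)
  moreover have "P $$ (a, b) = (\<Sum>i<n + 2. \<Sum>j<n + 2. M' i a * K' i j * M' j b)" if "a < m" "b < m" for a b
    unfolding D(5)[OF that] two by (simp add: M'_def K'_def)
  ultimately have F': "skew_factorization d m P {..<n + 2} \<delta>' M' K'"
    unfolding skew_factorization_def by blast
  have "nonsingular_at d {..<n + 2} \<delta>' K' x" for x
    unfolding row_indep_def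
  proof (intro allI impI ballI)
    fix c i assume c: "\<forall>j\<in>{..<n + 2}. (\<Sum>i\<in>{..<n + 2}. c i * ev x (d - \<delta>' i - \<delta>' j) (K' i j)) = 0"
      and i: "i \<in> {..<n + 2}"
    have one: "ev x 0 1 = 1" by (cases x) auto
    have "c i = 0" if "i < n" for i
    proof (rule row_indepD[OF ns[of x]])
      fix j assume j: "j \<in> {..<n}"
      have "(\<Sum>i\<in>{..<n + 2}. c i * ev x (d - \<delta>' i - \<delta>' j) (K' i j)) = (\<Sum>i<n. c i * ev x (d - \<delta> i - \<delta> j) (K i j))"
        using j unfolding two by (simp add: K'_def \<delta>'_def)
      then show "(\<Sum>i<n. c i * ev x (d - \<delta> i - \<delta> j) (K i j)) = 0" using c j by simp
    qed (use that in simp)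
    moreover have "c (n + 1) = 0"
    proof -
      have "(\<Sum>i\<in>{..<n + 2}. c i * ev x (d - \<delta>' i - \<delta>' n) (K' i n)) = - c (n + 1)"
        unfolding two by (simp add: K'_def \<delta>'_def ev_minus one)
      then show ?thesis using c by simp
    qed
    moreover have "c n = 0"
    proof -
      have "(\<Sum>i\<in>{..<n + 2}. c i * ev x (d - \<delta>' i - \<delta>' (n + 1)) (K' i (n + 1))) = c n"
        unfolding two by (simp add: K'_def \<delta>'_def one)
      then show ?thesis using c by simp
    qed
    ultimately show "c i = 0" using i lt by auto
  qed
  with F' show ?thesis by blast
qed

lemma skew_factorization_exists:
  assumes P: "P \<in> POL_ss d m" and rank: "normal_rank m P \<le> 2 * r"
  shows "\<exists>\<delta> M K. skew_factorization d m P {..<2 * r} \<delta> M K \<and> (\<forall>x. nonsingular_at d {..<2 * r} \<delta> K x)"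
proof -
  note PD = POL_ssD[OF P]
  define M0 where "M0 i a = (if i = a then 1 else 0 :: complex poly)" for i a :: nat
  have "P $$ (a, b) = (\<Sum>i<m. \<Sum>j<m. M0 i a * P $$ (i, j) * M0 j b)" if "a < m" "b < m" for a b
  proof -
    have "(\<Sum>j<m. M0 i a * P $$ (i, j) * M0 j b) = (if i = a then P $$ (i, b) else 0)" for i
      using that by (simp add: M0_def if_distrib[where f = "\<lambda>x. _ * x"] sum.delta cong: if_cong)
    then show ?thesis using that by (simp add: sum.delta)
  qed
  moreover have "degree (M0 i a) \<le> 0" for i a by (simp add: M0_def)
  moreover have "P $$ (i, j) = 0 \<or> degree (P $$ (i, j)) + 0 + 0 \<le> d" "P $$ (j, i) = - P $$ (i, j)"
    if "i \<in> {..<m}" "j \<in> {..<m}" for i j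
    using PD(2)[of i j] PD(3)[of i j] that by simp_all
  ultimately have F0: "skew_factorization d m P {..<m} (\<lambda>_. 0) M0 (\<lambda>i j. P $$ (i, j))"
    unfolding skew_factorization_def by blast
  have "row_indep {..<m} {..<m} (\<lambda>i a. poly (M0 i a) \<alpha>)" for \<alpha>
  proof -
    have "(\<Sum>i<m. c i * poly (M0 i a) \<alpha>) = c a" if "a < m" for c a
      using that by (simp add: M0_def if_distrib[where f = "\<lambda>x. poly x _"] if_distrib[where f = "\<lambda>x. _ * x"] sum.delta cong: if_cong)
    then show ?thesis by (auto simp: row_indep_def)
  qed
  then have "full_rank_cofinite {..<m} m M0" by (simp add: full_rank_cofinite_def)
  from skew_factorization_nonsingular[OF F0 this] obtain I \<delta>1 M1 K1
    where F1: "skew_factorization d m P I \<delta>1 M1 K1" and fr: "full_rank_cofinite I m M1"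
      and ns: "\<And>x. nonsingular_at d I \<delta>1 K1 x" by auto
  define n where "n = card I"
  obtain h where h: "bij_betw h {..<n} I"
    using ex_bij_betw_nat_finite[OF skew_factorizationD(1)[OF F1]] by (auto simp: n_def lessThan_atLeast0)
  have I: "I \<subseteq> h ` {..<n}" using h by (simp add: bij_betw_def)
  define \<delta>2 where "\<delta>2 = (\<lambda>i. \<delta>1 (h i))"
  define M2 where "M2 = (\<lambda>i. M1 (h i))"
  define K2 where "K2 = (\<lambda>i j. K1 (h i) (h j))"
  have F2: "skew_factorization d m P {..<n} \<delta>2 M2 K2"
    unfolding \<delta>2_def M2_def K2_def by (rule skew_factorization_reindex[OF F1 h])
  have ns2: "nonsingular_at d {..<n} \<delta>2 K2 x" for x
    using row_indep_reindex[OF ns h I] unfolding \<delta>2_def K2_def .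
  obtain \<alpha> where "row_indep I {..<m} (\<lambda>i a. poly (M1 i a) \<alpha>)"
    using fr ex_new_if_finite[OF infinite_UNIV_char_0] unfolding full_rank_cofinite_def by blast
  from row_indep_reindex[OF this h, of id "{..<m}"]
  have "row_indep {..<n} {..<m} (\<lambda>i a. poly (M2 i a) \<alpha>)" by (simp add: M2_def)
  moreover have Ka: "row_indep {..<n} {..<n} (\<lambda>i j. poly (K2 i j) \<beta>)" for \<beta>
    using ns2[of "Some \<beta>"] by simp
  moreover have "eval_mat P \<alpha> $$ (a, b) = (\<Sum>i<n. \<Sum>j<n. poly (M2 i a) \<alpha> * poly (K2 i j) \<alpha> * poly (M2 j b) \<alpha>)"
    if "a < m" "b < m" for a b
    using skew_factorizationD(5)[OF F2 that] PD(1) that by (simp add: poly_sum)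
  ultimately have "n \<le> vec_space.rank m (eval_mat P \<alpha>)"
    using PD(1) by (intro rank_congruence) auto
  also have "\<dots> \<le> 2 * r" using rank_eval_le_normal_rank[OF PD(1)] rank order_trans by blast
  finally have n2: "n \<le> 2 * r" .
  have "even n"
  proof (rule even_dim_if_skew_nonsingular[OF Ka[of 0]])
    show "poly (K2 j i) 0 = - poly (K2 i j) 0" if "i < n" "j < n" for i j
      using skew_factorizationD(4)[OF F2, of i j] that by simp
  qed
  have pad: "\<exists>\<delta> M K. skew_factorization d m P {..<n + 2 * k} \<delta> M K \<and> (\<forall>x. nonsingular_at d {..<n + 2 * k} \<delta> K x)" for k
  proof (induction k)
    case 0
    then show ?case using F2 ns2 by auto
  next
    case (Suc k)
    then obtain \<delta> M K where "skew_factorization d m P {..<n + 2 * k} \<delta> M K"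
      "\<And>x. nonsingular_at d {..<n + 2 * k} \<delta> K x" by blast
    from skew_factorization_pad[OF this] show ?case by (simp add: add.assoc)
  qed
  have "n + 2 * (r - n div 2) = 2 * r" using \<open>even n\<close> n2 by (auto elim!: evenE)
  then show ?thesis using pad[of "r - n div 2"] by simp
qed

section \<open>Perturbation to full rank on the projective line\<close>

definition row_span :: "nat \<Rightarrow> nat \<Rightarrow> (nat \<Rightarrow> nat \<Rightarrow> complex) \<Rightarrow> (nat \<Rightarrow> complex) \<Rightarrow> bool" where
  "row_span k m R u \<longleftrightarrow> (\<exists>c. \<forall>a<m. u a = (\<Sum>i<k. c i * R i a))"

lemma row_span_cong:
  "(\<And>i a. i < k \<Longrightarrow> a < m \<Longrightarrow> R i a = R' i a) \<Longrightarrow> (\<And>a. a < m \<Longrightarrow> u a = u' a) \<Longrightarrow>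
   row_span k m R u = row_span k m R' u'"
  by (simp add: row_span_def)

lemma row_indep_cong:
  "(\<And>i j. i \<in> I \<Longrightarrow> j \<in> J \<Longrightarrow> A i j = B i j) \<Longrightarrow> row_indep I J A = row_indep I J B"
  by (simp add: row_indep_def)

lemma row_span_lincomb:
  assumes "row_span k m R u" "row_span k m R v"
  shows "row_span k m R (\<lambda>a. s * u a + t * v a)"
proof -
  obtain c e where "\<forall>a<m. u a = (\<Sum>i<k. c i * R i a)" "\<forall>a<m. v a = (\<Sum>i<k. e i * R i a)"
    using assms by (auto simp: row_span_def)
  then have "\<forall>a<m. s * u a + t * v a = (\<Sum>i<k. (s * c i + t * e i) * R i a)"
    by (simp add: sum_distrib_left sum.distrib algebra_simps)
  then show ?thesis unfolding row_span_def by (intro exI)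
qed

lemma row_indep_Suc:
  "row_indep {..<Suc k} {..<m} A \<longleftrightarrow> row_indep {..<k} {..<m} A \<and> \<not> row_span k m A (A k)"
proof (intro iffI conjI)
  assume A: "row_indep {..<Suc k} {..<m} A"
  show "row_indep {..<k} {..<m} A" by (rule row_indep_mono[OF A]) auto
  show "\<not> row_span k m A (A k)"
  proof
    assume "row_span k m A (A k)"
    then obtain c where c: "\<And>a. a < m \<Longrightarrow> A k a = (\<Sum>i<k. c i * A i a)" by (auto simp: row_span_def)
    have "(\<lambda>i. if i = k then - 1 else c i) k = 0"
      by (rule row_indepD[OF A, where c = "\<lambda>i. if i = k then - 1 else c i"]) (use c in auto)
    then show False by simp
  qed
next
  assume *: "row_indep {..<k} {..<m} A \<and> \<not> row_span k m A (A k)"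
  show "row_indep {..<Suc k} {..<m} A"
    unfolding row_indep_def
  proof (intro allI impI)
    fix c assume c: "\<forall>j\<in>{..<m}. (\<Sum>i\<in>{..<Suc k}. c i * A i j) = 0"
    have ck: "c k = 0"
    proof (rule ccontr)
      assume "c k \<noteq> 0"
      have "A k a = (\<Sum>i<k. (- c i / c k) * A i a)" if "a < m" for a
      proof -
        have "c k * A k a = - (\<Sum>i<k. c i * A i a)"
          using c that by (simp add: eq_neg_iff_add_eq_0 add.commute)
        then have "A k a = - (\<Sum>i<k. c i * A i a) / c k" using \<open>c k \<noteq> 0\<close> by (simp add: field_simps)
        then show ?thesis by (simp add: sum_divide_distrib sum_negf)
      qed
      then have "row_span k m A (A k)" unfolding row_span_def by (intro exI[of _ "\<lambda>i. - c i / c k"]) simp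
      then show False using * by simp
    qed
    then have "c i = 0" if "i < k" for i
      using c that by (intro row_indepD[OF conjunct1[OF *], where c = c]) auto
    with ck show "\<forall>i\<in>{..<Suc k}. c i = 0" by (auto simp: less_Suc_eq)
  qed
qed

lemma finite_row_dependent:
  fixes M :: "nat \<Rightarrow> nat \<Rightarrow> complex poly"
  assumes "row_indep {..<n} {..<m} (\<lambda>i a. poly (M i a) \<alpha>)"
  shows "finite {\<beta>. \<not> row_indep {..<n} {..<m} (\<lambda>i a. poly (M i a) \<beta>)}"
proof -
  define Y where "Y a j = cnj (poly (M j a) \<alpha>)" for a j
  define q where "q = det (mat n n (\<lambda>(i, j). \<Sum>a<m. M i a * [:Y a j:]))"
  have ev: "poly q \<beta> = det (mat n n (\<lambda>(i, j). \<Sum>a<m. poly (M i a) \<beta> * Y a j))" for \<beta>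
    unfolding q_def det_eval_mat[symmetric]
    by (intro arg_cong[of _ _ det] eq_matI) (auto simp: poly_sum mult.commute)
  have "poly q \<alpha> \<noteq> 0"
    using row_indep_gram[OF assms] unfolding ev Y_def row_indep_iff_det by simp
  then have "q \<noteq> 0" by auto
  moreover have "poly q \<beta> = 0" if dep: "\<not> row_indep {..<n} {..<m} (\<lambda>i a. poly (M i a) \<beta>)" for \<beta>
  proof (rule ccontr)
    assume "poly q \<beta> \<noteq> 0"
    then have N: "row_indep {..<n} {..<n} (\<lambda>i j. \<Sum>a<m. poly (M i a) \<beta> * Y a j)"
      unfolding ev row_indep_iff_det .
    have "row_indep {..<n} {..<m} (\<lambda>i a. poly (M i a) \<beta>)"
      unfolding row_indep_def
    proof (intro allI impI ballI)
      fix c i assume c: "\<forall>j\<in>{..<m}. (\<Sum>i<n. c i * poly (M i j) \<beta>) = 0" and i: "i \<in> {..<n}"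
      have "(\<Sum>i<n. c i * (\<Sum>a<m. poly (M i a) \<beta> * Y a j)) = 0" for j
      proof -
        have "(\<Sum>i<n. c i * (\<Sum>a<m. poly (M i a) \<beta> * Y a j)) = (\<Sum>i<n. \<Sum>a<m. c i * poly (M i a) \<beta> * Y a j)"
          by (simp add: sum_distrib_left mult_ac)
        also have "\<dots> = (\<Sum>a<m. \<Sum>i<n. c i * poly (M i a) \<beta> * Y a j)" by (rule sum.swap)
        also have "\<dots> = (\<Sum>a<m. (\<Sum>i<n. c i * poly (M i a) \<beta>) * Y a j)" by (simp add: sum_distrib_right)
        also have "\<dots> = 0" using c by (intro sum.neutral) simp
        finally show ?thesis .
      qed
      then show "c i = 0" using row_indepD[OF N] i by blast
    qed
    then show False using dep by simp
  qed
  ultimately show ?thesis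
    by (intro finite_subset[OF _ poly_roots_finite[of q]]) auto
qed

text \<open>A point of the moment curve \<open>s \<mapsto> (1, s, s\<^sup>2, \<dots>)\<close> lies in a given hyperplane for only finitely
  many \<open>s\<close>.\<close>

lemma avoid_row_spans:
  assumes fin: "finite F" and k: "\<And>x. x \<in> F \<Longrightarrow> k x < m"
  shows "\<exists>w. \<forall>x\<in>F. \<not> row_span (k x) m (R x) w"
proof -
  have "\<exists>h. (\<exists>a<m. h a \<noteq> 0) \<and> (\<forall>i<k x. (\<Sum>a<m. R x i a * h a) = 0)" if x: "x \<in> F" for x
  proof -
    let ?B = "mat (k x) m (\<lambda>(i, a). R x i a)"
    obtain v where v: "v \<in> carrier_vec m" "v \<noteq> 0\<^sub>v m" "?B *\<^sub>v v = 0\<^sub>v (k x)"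
      using wide_mat_kernel[of ?B "k x" m] k[OF x] by auto
    have "(\<Sum>a<m. R x i a * vec_index v a) = 0" if "i < k x" for i
    proof -
      have "(\<Sum>a<m. R x i a * vec_index v a) = vec_index (?B *\<^sub>v v) i"
        using that v(1) by (simp add: scalar_prod_def lessThan_atLeast0)
      then show ?thesis using v(3) that by simp
    qed
    then show ?thesis using v(1,2) by (intro exI[of _ "vec_index v"]) (auto simp: vec_eq_iff)
  qed
  then obtain h where h: "\<And>x. x \<in> F \<Longrightarrow> \<exists>a<m. h x a \<noteq> 0"
    "\<And>x i. x \<in> F \<Longrightarrow> i < k x \<Longrightarrow> (\<Sum>a<m. R x i a * h x a) = 0" by metis
  define q where "q x = (\<Sum>a<m. monom (h x a) a)" for x
  have coeff: "coeff (q x) a = h x a" if "a < m" for x a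
    using that by (simp add: q_def coeff_sum coeff_monom sum.delta)
  have "(\<Prod>x\<in>F. q x) \<noteq> 0"
  proof (subst prod_zero_iff[OF fin], rule notI, elim bexE)
    fix x assume "x \<in> F" "q x = 0"
    then show False using h(1)[of x] coeff[of _ x] by auto
  qed
  then obtain s where s: "poly (\<Prod>x\<in>F. q x) s \<noteq> 0" using poly_all_0_iff_0 by blast
  have "\<not> row_span (k x) m (R x) (\<lambda>a. s ^ a)" if x: "x \<in> F" for x
  proof
    assume "row_span (k x) m (R x) (\<lambda>a. s ^ a)"
    then obtain c where c: "\<And>a. a < m \<Longrightarrow> s ^ a = (\<Sum>i<k x. c i * R x i a)" by (auto simp: row_span_def)
    have "poly (q x) s = (\<Sum>a<m. h x a * s ^ a)" by (simp add: q_def poly_sum poly_monom)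
    also have "\<dots> = (\<Sum>a<m. \<Sum>i<k x. c i * (R x i a * h x a))"
      using c by (intro sum.cong) (simp_all add: sum_distrib_left mult_ac)
    also have "\<dots> = (\<Sum>i<k x. \<Sum>a<m. c i * (R x i a * h x a))" by (rule sum.swap)
    also have "\<dots> = (\<Sum>i<k x. c i * (\<Sum>a<m. R x i a * h x a))" by (simp add: sum_distrib_left)
    also have "\<dots> = 0" using h(2)[OF x] by simp
    finally show False using s x fin by (auto simp: poly_prod)
  qed
  then show ?thesis by blast
qed

lemma small_multiple:
  fixes w :: "nat \<Rightarrow> complex poly"
  assumes "e > 0"
  obtains \<tau> where "\<tau> > 0" "\<And>t a j. cmod t < \<tau> \<Longrightarrow> a < m \<Longrightarrow> cmod (coeff ([:t:] * w a) j) < e"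
proof -
  define B where "B = 1 + (\<Sum>a<m. \<Sum>j\<le>degree (w a). cmod (coeff (w a) j))"
  have B: "cmod (coeff (w a) j) < B" if "a < m" for a j
  proof (cases "j \<le> degree (w a)")
    case True
    have "cmod (coeff (w a) j) \<le> (\<Sum>j\<le>degree (w a). cmod (coeff (w a) j))"
      using True by (intro member_le_sum) auto
    also have "\<dots> \<le> (\<Sum>a<m. \<Sum>j\<le>degree (w a). cmod (coeff (w a) j))"
      using that by (intro member_le_sum[where f = "\<lambda>a. \<Sum>j\<le>degree (w a). cmod (coeff (w a) j)"]) (auto intro: sum_nonneg)
    finally show ?thesis by (simp add: B_def)
  next
    case False
    then show ?thesis by (auto simp: B_def coeff_eq_0 intro!: add_pos_nonneg sum_nonneg)
  qed
  have Bpos: "B > 0" unfolding B_def by (intro add_pos_nonneg sum_nonneg) auto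
  show thesis
  proof (rule that[of "e / B"])
    show "e / B > 0" using assms Bpos by simp
    fix t :: complex and a j assume t: "cmod t < e / B" and a: "a < m"
    have "cmod t * cmod (coeff (w a) j) \<le> cmod t * B"
      using B[OF a, of j] by (intro mult_left_mono) auto
    also have "\<dots> < e" using t Bpos by (simp add: pos_less_divide_eq)
    finally show "cmod (coeff ([:t:] * w a) j) < e" by (simp add: norm_mult)
  qed
qed

lemma ev_const_mult:
  assumes "degree p \<le> g"
  shows "ev x g ([:t:] * p) = t * ev x g p"
  by (cases x) auto

abbreviation full_rank_at where
  "full_rank_at n m \<delta> M x \<equiv> row_indep {..<n} {..<m} (\<lambda>i a. ev x (\<delta> i) (M i a))"

text \<open>
  First move the row to \<open>v1\<close>, outside the span \<open>R x\<close> of the previous rows except for \<open>x\<close> in a finite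
  set \<open>A\<close>; then add a small multiple of some \<open>w\<close> that is outside the span at every point of \<open>A\<close>, and
  independent of \<open>v1\<close> modulo the span except at finitely many points. The latter needs two spare
  columns.
\<close>

lemma perturb_last_row:
  fixes M :: "nat \<Rightarrow> nat \<Rightarrow> complex poly"
  assumes k: "k + 2 \<le> m" and good: "\<And>x. full_rank_at k m \<delta> M x"
    and deg: "\<And>a. a < m \<Longrightarrow> degree (M k a) \<le> \<delta> k" and e: "e > 0"
  shows "\<exists>v. (\<forall>a<m. degree (v a) \<le> \<delta> k \<and> (\<forall>j. cmod (coeff (v a) j - coeff (M k a) j) < e)) \<and>
    (\<forall>x. full_rank_at (Suc k) m \<delta> (M(k := v)) x)"
proof -
  define R where "R x i a = ev x (\<delta> i) (M i a)" for x i a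
  have Rgood: "row_indep {..<k} {..<m} (R x)" for x using good unfolding R_def .
  have full_iff: "full_rank_at (Suc k) m \<delta> (M(k := v)) x \<longleftrightarrow> \<not> row_span k m (R x) (\<lambda>a. ev x (\<delta> k) (v a))" for v x
  proof -
    have "row_indep {..<k} {..<m} (\<lambda>i a. ev x (\<delta> i) ((M(k := v)) i a)) = row_indep {..<k} {..<m} (R x)"
      by (rule row_indep_cong) (auto simp: R_def)
    moreover have "row_span k m (\<lambda>i a. ev x (\<delta> i) ((M(k := v)) i a)) (\<lambda>a. ev x (\<delta> k) ((M(k := v)) k a))
        = row_span k m (R x) (\<lambda>a. ev x (\<delta> k) (v a))"
      by (rule row_span_cong) (auto simp: R_def)
    ultimately show ?thesis unfolding row_indep_Suc using Rgood by blast
  qed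
  define x0 where "x0 = Some (0 :: complex)"
  obtain v1 where v1deg: "\<And>a. a < m \<Longrightarrow> degree (v1 a) \<le> \<delta> k"
    and v1close: "\<And>a j. a < m \<Longrightarrow> cmod (coeff (v1 a) j - coeff (M k a) j) < e / 2"
    and v1x0: "\<not> row_span k m (R x0) (\<lambda>a. ev x0 (\<delta> k) (v1 a))"
  proof (cases "row_span k m (R x0) (\<lambda>a. ev x0 (\<delta> k) (M k a))")
    case False
    then show thesis using that[of "M k"] deg e by simp
  next
    case True
    obtain w where w: "\<not> row_span k m (R x0) w"
      using avoid_row_spans[of "{x0}" "\<lambda>_. k" m R] k by auto
    obtain \<tau> where \<tau>: "\<tau> > 0" "\<And>t a j. cmod t < \<tau> \<Longrightarrow> a < m \<Longrightarrow> cmod (coeff ([:t:] * [:w a:]) j) < e / 2"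
      using small_multiple[of "e / 2" m "\<lambda>a. [:w a:]"] e by auto
    define t where "t = complex_of_real (\<tau> / 2)"
    have t: "cmod t < \<tau>" "t \<noteq> 0" using \<tau>(1) by (auto simp: t_def)
    show thesis
    proof (rule that[of "\<lambda>a. M k a + [:t:] * [:w a:]"])
      show "degree (M k a + [:t:] * [:w a:]) \<le> \<delta> k" if "a < m" for a
        using deg[OF that] by (intro degree_add_le) auto
      show "cmod (coeff (M k a + [:t:] * [:w a:]) j - coeff (M k a) j) < e / 2" if "a < m" for a j
        using \<tau>(2)[OF t(1) that, of j] by simp
      show "\<not> row_span k m (R x0) (\<lambda>a. ev x0 (\<delta> k) (M k a + [:t:] * [:w a:]))"
      proof
        assume "row_span k m (R x0) (\<lambda>a. ev x0 (\<delta> k) (M k a + [:t:] * [:w a:]))"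
        from row_span_lincomb[OF this True, of "1 / t" "- 1 / t"]
        have "row_span k m (R x0) w" using t(2) by (simp add: x0_def field_simps)
        then show False using w by simp
      qed
    qed
  qed
  define A where "A = {x. row_span k m (R x) (\<lambda>a. ev x (\<delta> k) (v1 a))}"
  have finA: "finite A"
  proof -
    have eq: "row_indep {..<Suc k} {..<m} (\<lambda>i a. poly ((M(k := v1)) i a) \<alpha>) \<longleftrightarrow> Some \<alpha> \<notin> A" for \<alpha>
      using full_iff[where v = v1 and x = "Some \<alpha>"] by (simp add: A_def)
    have "finite {\<beta>. \<not> row_indep {..<Suc k} {..<m} (\<lambda>i a. poly ((M(k := v1)) i a) \<beta>)}"
      using finite_row_dependent[of "Suc k" m "M(k := v1)" 0] eq[of 0] v1x0 by (simp add: A_def x0_def)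
    then have "finite {\<beta>. Some \<beta> \<in> A}" unfolding eq by simp
    moreover have "A \<subseteq> insert None (Some ` {\<beta>. Some \<beta> \<in> A})" by (auto simp: image_iff) (metis not_None_eq)
    ultimately show ?thesis by (meson finite.insertI finite_imageI finite_subset)
  qed
  define S where "S z = (case z of None \<Rightarrow> (Suc k, \<lambda>i a. ev x0 (\<delta> i) ((M(k := v1)) i a)) | Some x \<Rightarrow> (k, R x))" for z
  obtain w0 where w0: "\<And>z. z \<in> insert None (Some ` A) \<Longrightarrow> \<not> row_span (fst (S z)) m (snd (S z)) w0"
  proof -
    have "fst (S z) < m" for z using k by (simp add: S_def split: option.split)
    then show thesis
      using avoid_row_spans[of "insert None (Some ` A)" "\<lambda>z. fst (S z)" m "\<lambda>z. snd (S z)"] finA that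
      by blast
  qed
  have w0x0: "\<not> row_span (Suc k) m (\<lambda>i a. ev x0 (\<delta> i) ((M(k := v1)) i a)) w0"
    using w0[of None] by (simp add: S_def)
  have w0A: "\<not> row_span k m (R x) w0" if "x \<in> A" for x
    using w0[of "Some x"] that by (simp add: S_def)
  obtain \<beta> where \<beta>: "\<beta> \<noteq> 0" "Some \<beta> \<notin> A"
  proof -
    have "finite (insert 0 (Some -` A))" using finA by (simp add: finite_vimageI)
    then show thesis using ex_new_if_finite[OF infinite_UNIV_char_0] that by (metis insertCI vimageI)
  qed
  define f where "f = [:- \<beta>, 1:] ^ \<delta> k"
  have fdeg: "degree f = \<delta> k" by (simp add: f_def degree_power_eq)
  have "lead_coeff f = 1" by (simp add: f_def lead_coeff_power)
  then have fN: "ev None (\<delta> k) f = 1" using fdeg by simp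
  have fev: "ev x (\<delta> k) f \<noteq> 0" if "x \<in> insert x0 A" for x
    using that \<beta> fN by (cases x) (auto simp: f_def x0_def)
  define w where "w a = [:w0 a:] * f" for a
  have wdeg: "degree (w a) \<le> \<delta> k" for a
    using degree_mult_le[of "[:w0 a:]" f] fdeg by (simp add: w_def)
  have wev: "ev x (\<delta> k) (w a) = w0 a * ev x (\<delta> k) f" for x a
    unfolding w_def using fdeg by (intro ev_const_mult) simp
  have wspan: "\<not> row_span k' m R' (\<lambda>a. ev x (\<delta> k) (w a))"
    if "x \<in> insert x0 A" "\<not> row_span k' m R' w0" for x k' R'
  proof
    assume "row_span k' m R' (\<lambda>a. ev x (\<delta> k) (w a))"
    from row_span_lincomb[OF this this, of "1 / ev x (\<delta> k) f" 0]
    show False using that fev[OF that(1)] by (simp add: wev)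
  qed
  define N where "N = M(k := v1, Suc k := w)"
  define E where "E = {x. case x of None \<Rightarrow> True | Some \<alpha> \<Rightarrow> \<not> row_indep {..<Suc (Suc k)} {..<m} (\<lambda>i a. poly (N i a) \<alpha>)}"
  have Nx0: "row_indep {..<Suc (Suc k)} {..<m} (\<lambda>i a. poly (N i a) 0)"
  proof -
    have "row_indep {..<Suc k} {..<m} (\<lambda>i a. poly (N i a) 0)
        = full_rank_at (Suc k) m \<delta> (M(k := v1)) x0"
      by (rule row_indep_cong) (auto simp: N_def x0_def)
    moreover have "row_span (Suc k) m (\<lambda>i a. poly (N i a) 0) (\<lambda>a. poly (N (Suc k) a) 0)
        = row_span (Suc k) m (\<lambda>i a. ev x0 (\<delta> i) ((M(k := v1)) i a)) (\<lambda>a. ev x0 (\<delta> k) (w a))"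
      by (rule row_span_cong) (auto simp: N_def x0_def)
    ultimately show ?thesis
      unfolding row_indep_Suc[of "Suc k"] full_iff using v1x0 wspan[OF _ w0x0, of x0] by blast
  qed
  have finE: "finite E"
  proof -
    have "E \<subseteq> insert None (Some ` {\<alpha>. \<not> row_indep {..<Suc (Suc k)} {..<m} (\<lambda>i a. poly (N i a) \<alpha>)})"
    proof
      fix x assume "x \<in> E"
      then show "x \<in> insert None (Some ` {\<alpha>. \<not> row_indep {..<Suc (Suc k)} {..<m} (\<lambda>i a. poly (N i a) \<alpha>)})"
        by (cases x) (auto simp: E_def)
    qed
    then show ?thesis
      using finite_row_dependent[OF Nx0] by (meson finite.insertI finite_imageI finite_subset)
  qed
  have outE: "\<not> row_span k m (R x) (\<lambda>a. ev x (\<delta> k) (v1 a + [:t:] * w a))" if xE: "x \<notin> E" for x t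
  proof
    assume span: "row_span k m (R x) (\<lambda>a. ev x (\<delta> k) (v1 a + [:t:] * w a))"
    obtain \<alpha> where x: "x = Some \<alpha>" using xE by (cases x) (auto simp: E_def)
    have ri: "row_indep {..<Suc (Suc k)} {..<m} (\<lambda>i a. poly (N i a) \<alpha>)"
      using xE by (simp add: E_def x)
    obtain c where c: "\<And>a. a < m \<Longrightarrow> poly (v1 a) \<alpha> + t * poly (w a) \<alpha> = (\<Sum>i<k. c i * poly (M i a) \<alpha>)"
      using span by (auto simp: row_span_def x R_def)
    have "(\<lambda>i. if i < k then - c i else if i = k then 1 else t) k = 0"
      by (rule row_indepD[OF ri, where c = "\<lambda>i. if i < k then - c i else if i = k then 1 else t"])
        (auto simp: N_def sum_negf c[symmetric])
    then show False by simp
  qed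
  define bad where "bad x = {t. t \<noteq> 0 \<and> row_span k m (R x) (\<lambda>a. ev x (\<delta> k) (v1 a + [:t:] * w a))}" for x
  have ev_sum2: "ev x (\<delta> k) (v1 a + [:t:] * w a) = ev x (\<delta> k) (v1 a) + t * ev x (\<delta> k) (w a)" for x t a
    by (simp only: ev_add ev_const_mult[OF wdeg])
  have "finite (bad x)" for x
  proof -
    have "t = t'" if "t \<in> bad x" "t' \<in> bad x" for t t'
    proof (rule ccontr)
      assume ne: "t \<noteq> t'"
      have s: "row_span k m (R x) (\<lambda>a. ev x (\<delta> k) (v1 a) + t * ev x (\<delta> k) (w a))"
        "row_span k m (R x) (\<lambda>a. ev x (\<delta> k) (v1 a) + t' * ev x (\<delta> k) (w a))"
        using that unfolding bad_def ev_sum2 by blast+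
      have "row_span k m (R x) (\<lambda>a. 1 / (t - t') * (ev x (\<delta> k) (v1 a) + t * ev x (\<delta> k) (w a))
          + (- 1 / (t - t')) * (ev x (\<delta> k) (v1 a) + t' * ev x (\<delta> k) (w a)))"
        by (rule row_span_lincomb[OF s])
      also have "(\<lambda>a. 1 / (t - t') * (ev x (\<delta> k) (v1 a) + t * ev x (\<delta> k) (w a))
          + (- 1 / (t - t')) * (ev x (\<delta> k) (v1 a) + t' * ev x (\<delta> k) (w a))) = (\<lambda>a. ev x (\<delta> k) (w a))"
        using ne by (simp add: fun_eq_iff divide_simps) (simp add: algebra_simps)
      finally have ws: "row_span k m (R x) (\<lambda>a. ev x (\<delta> k) (w a))" .
      from row_span_lincomb[OF s(1) ws, of 1 "- t"]
      have "x \<in> A" by (simp add: A_def)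
      then show False using wspan[of x k "R x"] w0A ws by blast
    qed
    then have "bad x \<subseteq> {SOME t. t \<in> bad x}" by (metis singletonI someI subsetI)
    then show ?thesis using finite_subset by blast
  qed
  then have finbad: "finite (\<Union>x\<in>E. bad x)" using finE by blast
  obtain \<tau> where \<tau>: "\<tau> > 0" "\<And>t a j. cmod t < \<tau> \<Longrightarrow> a < m \<Longrightarrow> cmod (coeff ([:t:] * w a) j) < e / 2"
    using small_multiple[of "e / 2" m w] e by auto
  have "infinite (complex_of_real ` {0<..<\<tau>})"
    using \<tau>(1) by (subst finite_image_iff) (auto simp: inj_on_def infinite_Ioo)
  then obtain t where t: "t \<in> complex_of_real ` {0<..<\<tau>}" "t \<notin> (\<Union>x\<in>E. bad x)"
    using finite_subset[OF subsetI finbad] by metis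
  then have t': "t \<noteq> 0" "cmod t < \<tau>" by auto
  define v where "v a = v1 a + [:t:] * w a" for a
  have "degree (v a) \<le> \<delta> k" if "a < m" for a
    using v1deg[OF that] wdeg[of a] degree_mult_le[of "[:t:]" "w a"]
    unfolding v_def by (intro degree_add_le) auto
  moreover have "cmod (coeff (v a) j - coeff (M k a) j) < e" if "a < m" for a j
  proof -
    have "coeff (v a) j - coeff (M k a) j = (coeff (v1 a) j - coeff (M k a) j) + coeff ([:t:] * w a) j"
      by (simp add: v_def)
    then have "cmod (coeff (v a) j - coeff (M k a) j)
        \<le> cmod (coeff (v1 a) j - coeff (M k a) j) + cmod (coeff ([:t:] * w a) j)"
      by (metis norm_triangle_ineq)
    then show ?thesis using v1close[OF that, of j] \<tau>(2)[OF t'(2) that, of j] by linarith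
  qed
  moreover have "full_rank_at (Suc k) m \<delta> (M(k := v)) x" for x
    unfolding full_iff v_def using outE[of x t] t(2) t'(1) by (cases "x \<in> E") (auto simp: bad_def)
  ultimately show ?thesis by blast
qed

lemma perturb_full_rank:
  fixes M :: "nat \<Rightarrow> nat \<Rightarrow> complex poly"
  assumes "n + 1 \<le> m" and deg: "\<And>i a. i < n \<Longrightarrow> a < m \<Longrightarrow> degree (M i a) \<le> \<delta> i" and e: "e > 0"
  shows "\<exists>M'. (\<forall>i<n. \<forall>a<m. degree (M' i a) \<le> \<delta> i \<and> (\<forall>j. cmod (coeff (M' i a) j - coeff (M i a) j) < e)) \<and>
    (\<forall>x. full_rank_at n m \<delta> M' x)"
  using assms(1,2)
proof (induction n)
  case 0
  then show ?case by (auto simp: row_indep_def)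
next
  case (Suc n)
  have "\<exists>M'. (\<forall>i<n. \<forall>a<m. degree (M' i a) \<le> \<delta> i \<and> (\<forall>j. cmod (coeff (M' i a) j - coeff (M i a) j) < e)) \<and>
    (\<forall>x. full_rank_at n m \<delta> M' x)"
    using Suc.prems by (intro Suc.IH) auto
  then obtain M' where M': "\<And>i a. i < n \<Longrightarrow> a < m \<Longrightarrow> degree (M' i a) \<le> \<delta> i"
    "\<And>i a j. i < n \<Longrightarrow> a < m \<Longrightarrow> cmod (coeff (M' i a) j - coeff (M i a) j) < e"
    "\<And>x. full_rank_at n m \<delta> M' x" by blast
  define M1 where "M1 = M'(n := M n)"
  have "full_rank_at n m \<delta> M1 x = full_rank_at n m \<delta> M' x" for x
    by (rule row_indep_cong) (auto simp: M1_def)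
  then have "full_rank_at n m \<delta> M1 x" for x using M'(3) by blast
  moreover have "degree (M1 n a) \<le> \<delta> n" if "a < m" for a using Suc.prems(2)[of n a] that by (simp add: M1_def)
  ultimately have "\<exists>v. (\<forall>a<m. degree (v a) \<le> \<delta> n \<and> (\<forall>j. cmod (coeff (v a) j - coeff (M1 n a) j) < e)) \<and>
      (\<forall>x. full_rank_at (Suc n) m \<delta> (M1(n := v)) x)"
    using Suc.prems(1) e by (intro perturb_last_row) auto
  then obtain v where v: "\<And>a. a < m \<Longrightarrow> degree (v a) \<le> \<delta> n"
    "\<And>a j. a < m \<Longrightarrow> cmod (coeff (v a) j - coeff (M1 n a) j) < e"
    "\<And>x. full_rank_at (Suc n) m \<delta> (M1(n := v)) x" by blast
  show ?case
    using M' v by (intro exI[of _ "M1(n := v)"]) (auto simp: M1_def less_Suc_eq)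
qed

section \<open>Density\<close>

lemma degree_skew_term:
  assumes F: "skew_factorization d m P I \<delta> M K" and ij: "i \<in> I" "j \<in> I" and ab: "a < m" "b < m"
  shows "degree (M i a * K i j * M j b) \<le> d"
    and "ev x d (M i a * K i j * M j b) = ev x (\<delta> i) (M i a) * ev x (d - \<delta> i - \<delta> j) (K i j) * ev x (\<delta> j) (M j b)"
proof -
  note D = skew_factorizationD[OF F]
  have "degree (M i a * K i j * M j b) \<le> d \<and>
    ev x d (M i a * K i j * M j b) = ev x (\<delta> i) (M i a) * ev x (d - \<delta> i - \<delta> j) (K i j) * ev x (\<delta> j) (M j b)"
  proof (cases "K i j = 0")
    case False
    then have le: "degree (K i j) + \<delta> i + \<delta> j \<le> d" using D(3)[OF ij] by blast
    then have eq: "d = (\<delta> i + (d - \<delta> i - \<delta> j)) + \<delta> j" by simp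
    have 1: "degree (M i a * K i j) \<le> \<delta> i + (d - \<delta> i - \<delta> j)"
      using degree_mult_le[of "M i a" "K i j"] D(2)[OF ij(1) ab(1)] le by linarith
    have "degree (M i a * K i j * M j b) \<le> (\<delta> i + (d - \<delta> i - \<delta> j)) + \<delta> j"
      using degree_mult_le[of "M i a * K i j" "M j b"] 1 D(2)[OF ij(2) ab(2)] by linarith
    moreover have "ev x ((\<delta> i + (d - \<delta> i - \<delta> j)) + \<delta> j) (M i a * K i j * M j b)
        = ev x (\<delta> i) (M i a) * ev x (d - \<delta> i - \<delta> j) (K i j) * ev x (\<delta> j) (M j b)"
      using 1 D(2)[OF ij(1) ab(1)] D(2)[OF ij(2) ab(2)] le
      by (subst ev_mult, simp, simp, subst ev_mult) auto
    ultimately show ?thesis using eq by simp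
  qed simp
  then show "degree (M i a * K i j * M j b) \<le> d"
    and "ev x d (M i a * K i j * M j b) = ev x (\<delta> i) (M i a) * ev x (d - \<delta> i - \<delta> j) (K i j) * ev x (\<delta> j) (M j b)"
    by blast+
qed

lemma POL_ss_skew_factorization:
  assumes F: "skew_factorization d m P I \<delta> M K" and P: "P \<in> carrier_mat m m"
  shows "P \<in> POL_ss d m"
proof (rule POL_ssI[OF P])
  note D = skew_factorizationD[OF F]
  fix a b assume ab: "a < m" "b < m"
  show "degree (P $$ (a, b)) \<le> d"
    unfolding D(5)[OF ab] using D(1) degree_skew_term(1)[OF F _ _ ab]
    by (intro degree_sum_le) auto
  have "P $$ (b, a) = (\<Sum>j\<in>I. \<Sum>i\<in>I. M i b * K i j * M j a)"
    unfolding D(5)[OF ab(2,1)] by (rule sum.swap)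
  also have "\<dots> = (\<Sum>j\<in>I. \<Sum>i\<in>I. - (M j a * K j i * M i b))"
  proof (intro sum.cong refl)
    fix i j assume "j \<in> I" "i \<in> I"
    then have "K i j = - K j i" by (rule D(4))
    then show "M i b * K i j * M j a = - (M j a * K j i * M i b)" by (simp add: mult_ac)
  qed
  also have "\<dots> = - P $$ (a, b)" unfolding D(5)[OF ab] by (simp add: sum_negf)
  finally show "P $$ (b, a) = - P $$ (a, b)" .
qed

lemma POL_ss_neig_skew_factorization:
  assumes F: "skew_factorization d m P {..<n} \<delta> M K" and P: "P \<in> carrier_mat m m" and "n > 0"
    and K: "\<And>x. nonsingular_at d {..<n} \<delta> K x" and M: "\<And>x. full_rank_at n m \<delta> M x"
  shows "P \<in> POL_ss_neig d n m"
proof -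
  have PS: "P \<in> POL_ss d m" by (rule POL_ss_skew_factorization[OF F P])
  note PD = POL_ssD[OF PS]
  define E where "E x = mat m m (\<lambda>(a, b). ev x d (P $$ (a, b)))" for x
  have rankE: "n \<le> vec_space.rank m (E x)" for x
  proof (rule rank_congruence[OF M K])
    fix a b assume ab: "a < m" "b < m"
    show "E x $$ (a, b) = (\<Sum>i<n. \<Sum>j<n. ev x (\<delta> i) (M i a) * ev x (d - \<delta> i - \<delta> j) (K i j) * ev x (\<delta> j) (M j b))"
      using ab by (simp add: E_def skew_factorizationD(5)[OF F] ev_sum degree_skew_term(2)[OF F])
  qed (simp add: E_def)
  have Eeval: "eval_mat P \<alpha> = E (Some \<alpha>)" for \<alpha>
    using P by (intro eq_matI) (auto simp: E_def)
  have Erev: "eval_mat (rev_pol d P) 0 = E None"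
  proof (rule eq_matI)
    fix i j assume "i < dim_row (E None)" "j < dim_col (E None)"
    then have ij: "i < m" "j < m" by (auto simp: E_def)
    have "poly (\<Sum>k\<le>d. monom (coeff p (d - k)) k) 0 = coeff p d" for p :: "complex poly"
    proof -
      have "poly (\<Sum>k\<le>d. monom (coeff p (d - k)) k) 0 = (\<Sum>k\<le>d. if k = 0 then coeff p (d - k) else 0)"
        unfolding poly_sum by (intro sum.cong) (auto simp: poly_monom)
      then show ?thesis by simp
    qed
    then show "eval_mat (rev_pol d P) 0 $$ (i, j) = E None $$ (i, j)"
      using ij P by (simp add: rev_pol_def E_def)
  qed (use P in \<open>auto simp: E_def rev_pol_def\<close>)
  have "normal_rank m P \<le> n"
  proof -
    obtain \<alpha> where \<alpha>: "normal_rank m P \<le> vec_space.rank m (eval_mat P \<alpha>)"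
      using ex_new_if_finite[OF infinite_UNIV_char_0 finite_rank_eval_less[OF P]] not_le by blast
    define B where "B = mat m n (\<lambda>(a, i). poly (M i a) \<alpha>)"
    define C where "C = mat n m (\<lambda>(i, b). \<Sum>j<n. poly (K i j) \<alpha> * poly (M j b) \<alpha>)"
    have "eval_mat P \<alpha> = B * C"
    proof (rule eq_matI)
      fix a b assume "a < dim_row (B * C)" "b < dim_col (B * C)"
      then have ab: "a < m" "b < m" by (auto simp: B_def C_def)
      then show "eval_mat P \<alpha> $$ (a, b) = (B * C) $$ (a, b)"
        using P by (simp add: skew_factorizationD(5)[OF F ab] B_def C_def poly_sum scalar_prod_def
            lessThan_atLeast0 sum_distrib_left mult.assoc)
    qed (use P in \<open>auto simp: B_def C_def\<close>)
    moreover have "vec_space.rank m (B * C) \<le> n"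
      by (rule rank_mult_le_inner) (auto simp: B_def C_def)
    ultimately show ?thesis using \<alpha> by simp
  qed
  moreover have "n \<le> normal_rank m P"
    using rankE[of "Some 0"] rank_eval_le_normal_rank[OF P, of 0] by (simp add: Eeval)
  ultimately have nr: "normal_rank m P = n" by simp
  have "\<not> finite_eigenvalue m P \<alpha>" for \<alpha>
    using rankE[of "Some \<alpha>"] by (intro not_finite_eigenvalueI[OF P]) (simp add: nr Eeval)
  moreover have "\<not> infinite_eigenvalue d m P"
  proof -
    have "normal_rank m (rev_pol d P) \<le> vec_space.rank m (eval_mat (rev_pol d P) 0)"
      using normal_rank_rev_pol_le[OF P PD(2)] rankE[of None] by (simp add: Erev nr)
    then show ?thesis
      unfolding infinite_eigenvalue_def using P by (intro not_finite_eigenvalueI) (simp_all add: rev_pol_def)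
  qed
  ultimately have "no_eigenvalues d m P" by (simp add: no_eigenvalues_def)
  moreover have "pol_degree m P = d"
    unfolding pol_degree_def
  proof (rule Max_eqI)
    have sub: "{k. coeff_mat m P k \<noteq> 0\<^sub>m m m} \<subseteq> {..d}"
      using PS by (auto simp: POL_ss_def not_le[symmetric])
    then show "finite {k. coeff_mat m P k \<noteq> 0\<^sub>m m m}" using finite_subset by blast
    show "k \<le> d" if "k \<in> {k. coeff_mat m P k \<noteq> 0\<^sub>m m m}" for k using sub that by blast
    have "coeff_mat m P d = E None" by (simp add: coeff_mat_def E_def)
    then have "coeff_mat m P d \<noteq> 0\<^sub>m m m"
      using rankE[of None] \<open>n > 0\<close> vec_space.rank_0I[where ?'a = complex, of m m] by auto
    then show "d \<in> {k. coeff_mat m P k \<noteq> 0\<^sub>m m m}" by simp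
  qed
  ultimately show ?thesis using PS nr by (simp add: POL_ss_neig_def POL_ss_rank_def)
qed

lemma approx_by_no_eigenvalues:
  assumes P: "P \<in> POL_ss_rank d (2 * r) m" and r: "r > 0" "2 * r + 1 \<le> m" and e: "e > 0"
  shows "\<exists>Q\<in>POL_ss_neig d (2 * r) m. pol_dist d m P Q < e"
proof -
  have PS: "P \<in> POL_ss d m" and rk: "normal_rank m P \<le> 2 * r" using P by (auto simp: POL_ss_rank_def)
  obtain \<delta> M K where F: "skew_factorization d m P {..<2 * r} \<delta> M K"
    and K: "\<And>x. nonsingular_at d {..<2 * r} \<delta> K x"
    using skew_factorization_exists[OF PS rk] by blast
  note D = skew_factorizationD[OF F]
  define close where "close n N \<longleftrightarrow> (\<forall>i<2 * r. \<forall>a<m. degree (N i a) \<le> \<delta> i \<and>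
      (\<forall>j. cmod (coeff (N i a) j - coeff (M i a) j) < inverse (real (Suc n)))) \<and>
    (\<forall>x. full_rank_at (2 * r) m \<delta> N x)" for n N
  have "\<exists>N. close n N" for n
    unfolding close_def using r D(2) by (intro perturb_full_rank) auto
  then obtain N where close: "\<And>n. close n (N n)" by metis
  have N: "\<And>n i a. i < 2 * r \<Longrightarrow> a < m \<Longrightarrow> degree (N n i a) \<le> \<delta> i"
    "\<And>n i a j. i < 2 * r \<Longrightarrow> a < m \<Longrightarrow> cmod (coeff (N n i a) j - coeff (M i a) j) < inverse (real (Suc n))"
    "\<And>n x. full_rank_at (2 * r) m \<delta> (N n) x"
    using close unfolding close_def by blast+
  define Q where "Q n = mat m m (\<lambda>(a, b). \<Sum>i<2 * r. \<Sum>j<2 * r. N n i a * K i j * N n j b)" for n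
  have neig: "Q n \<in> POL_ss_neig d (2 * r) m" for n
  proof (rule POL_ss_neig_skew_factorization[OF _ _ _ K N(3)])
    show "skew_factorization d m (Q n) {..<2 * r} \<delta> (N n) K"
      unfolding skew_factorization_def
    proof (intro conjI)
      show "\<forall>i\<in>{..<2 * r}. \<forall>j\<in>{..<2 * r}. K j i = - K i j" using D(4) by blast
      show "\<forall>i\<in>{..<2 * r}. \<forall>j\<in>{..<2 * r}. K i j = 0 \<or> degree (K i j) + \<delta> i + \<delta> j \<le> d"
        using D(3) by blast
      show "\<forall>i\<in>{..<2 * r}. \<forall>a<m. degree (N n i a) \<le> \<delta> i" using N(1) by simp
    qed (simp_all add: Q_def)
  qed (use r in \<open>simp_all add: Q_def\<close>)
  have lim: "(\<lambda>n. coeff (N n i a) j) \<longlonglongrightarrow> coeff (M i a) j" if "i < 2 * r" "a < m" for i a j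
  proof (rule LIM_zero_cancel, rule Lim_null_comparison[OF _ LIMSEQ_inverse_real_of_nat])
    show "\<forall>\<^sub>F n in sequentially. norm (coeff (N n i a) j - coeff (M i a) j) \<le> inverse (real (Suc n))"
      using N(2)[OF that] by (intro always_eventually allI less_imp_le)
  qed
  have "(\<lambda>n. pol_dist d m P (Q n)) \<longlonglongrightarrow> 0"
  proof (rule pol_dist_tendsto_0)
    fix a b k assume ab: "a < m" "b < m"
    show "(\<lambda>n. coeff (Q n $$ (a, b)) k) \<longlonglongrightarrow> coeff (P $$ (a, b)) k"
      unfolding D(5)[OF ab] using ab
      by (simp add: Q_def coeff_sum coeff_mult) (intro tendsto_intros lim; simp)
  qed
  then have "\<forall>\<^sub>F n in sequentially. pol_dist d m P (Q n) < e"
    using e by (rule order_tendstoD(2))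
  then obtain n where "pol_dist d m P (Q n) < e" using eventually_sequentially by auto
  then show ?thesis using neig by blast
qed

theorem lemma3p4:
  fixes m r d :: nat
  assumes "d \<ge> 1" and "2 \<le> 2 * r" and "2 * r \<le> m - 1"
  shows "Metric_space.mtopology (POL_ss d m) (pol_dist d m) closure_of POL_ss_neig d (2 * r) m
       = POL_ss_rank d (2 * r) m"
proof -
  interpret Metric_space "POL_ss d m" "pol_dist d m" by (rule Metric_space_POL_ss)
  have neig: "Q \<in> POL_ss d m \<and> normal_rank m Q \<le> 2 * r" if "Q \<in> POL_ss_neig d (2 * r) m" for Q
    using that by (simp add: POL_ss_neig_def POL_ss_rank_def)
  show ?thesis
  proof (intro equalityI subsetI)
    fix P assume "P \<in> mtopology closure_of POL_ss_neig d (2 * r) m"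
    then have P: "P \<in> POL_ss d m"
      and approx: "\<And>e. e > 0 \<Longrightarrow> \<exists>Q\<in>POL_ss_neig d (2 * r) m. Q \<in> mball P e"
      unfolding metric_closure_of by auto
    have "normal_rank m P \<le> 2 * r"
      using approx neig by (intro normal_rank_le_closed[OF P]) (metis in_mball)
    then show "P \<in> POL_ss_rank d (2 * r) m" using P by (simp add: POL_ss_rank_def)
  next
    fix P assume P: "P \<in> POL_ss_rank d (2 * r) m"
    then have PS: "P \<in> POL_ss d m" by (simp add: POL_ss_rank_def)
    have "\<exists>Q\<in>POL_ss_neig d (2 * r) m. Q \<in> mball P e" if "e > 0" for e
      using approx_by_no_eigenvalues[OF P _ _ that] assms PS neig by auto
    then show "P \<in> mtopology closure_of POL_ss_neig d (2 * r) m"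
      unfolding metric_closure_of using PS by auto
  qed
qed

end
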